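(* Let $\mathcal{H}$ be a type-definable, definably amenable subgroup of $\mathcal{G}$, defined by a partial type $H(x)$. Suppose that $\mu \in \mathfrak{M}_{x}(\mathcal{G})$ is right $\mathcal{H}$-invariant. Then $\mu$ is idempotent. Moreover, if $\nu\in\mathfrak{M}_x(\mathcal{G})$ is another measure such that $\nu(H(x)) = 1$, then $(\mu,\nu)$ is $*$-Borel and $\mu * \nu = \mu$.
   Context: Setting: $T$ is an arbitrary first-order theory in a language $\mathcal{L}$ expanding a group, $\mathcal{G}$ is a sufficiently saturated (monster) model of $T$, and "small" means small relative to the saturation of $\mathcal{G}$. The variable $x$ (and $y$ in convolutions) is a singleton variable of the sort on which the group is defined. "Type-definable" means defined by a partial type over a small set. Keisler measures: for $A\subseteq\mathcal{G}$, $\mathcal{L}_x(A)$ is the Boolean algebra of formulas in $x$ with parameters from $A$ (up to equivalence), $S_x(A)$ is the space of types over $A$, and $\mathfrak{M}_x(A)$ is the set of Keisler measures over $A$, i.e. finitely additive probability measures on $\mathcal{L}_x(A)$; each is identified with the corresponding regular Borel probability measure on $S_x(A)$. $\mu|_A$ denotes restriction. The support of $\mu\in\mathfrak{M}_x(A)$ is $S(\mu)=\{p\in S_x(A):\mu(\varphi(x))>0 \text{ for all }\varphi(x)\in p\}$. For a partial type $H(x)$, $\mu(H(x))$ is the measure of the closed set of types implying $H(x)$. Definable amenability: a type-definable subgroup $\mathcal{H}$ of $\mathcal{G}$ with defining partial type $H(x)$ is definably amenable if there is $\mu\in\mathfrak{M}_x(\mathcal{G})$ with $\mu(H(x))=1$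 and $\mu(\varphi(x))=\mu(\varphi(x\cdot a))$ for all $\varphi(x)\in\mathcal{L}_x(\mathcal{G})$ and $a\in\mathcal{H}$. Such a $\mu$ (satisfying both conditions) is called right $\mathcal{H}$-invariant. Convolution: for $\mu,\nu\in\mathfrak{M}_x(\mathcal{G})$ let $\nu_y$ be $\nu$ viewed as a measure in the variable $y$. The pair $(\mu,\nu)$ is $*$-Borel if for every $\varphi(x,\bar c)\in\mathcal{L}_x(\mathcal{G})$ there is a small $N\prec\mathcal{G}$ containing $\bar c$ such that for every $q\in S(\nu_y|_N)$ the value $F(q):=\mu(\varphi(x\cdot d,\bar c))$ is the same for all $d\models q$ in $\mathcal{G}$, and $F:S(\nu_y|_N)\to[0,1]$ is Borel. Then $(\mu*\nu)(\varphi(x,\bar c)):=\int_{S(\nu_y|_N)}F\,d\nu_N$, where $\nu_N$ is the Borel measure $\nu_y|_N$ restricted to its support (this does not depend on $N$). $\mu$ is idempotent if $(\mu,\mu)$ is $*$-Borel and $\mu*\mu=\mu$. *)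

theory Defs
  imports "HOL-Analysis.Analysis" "HOL-Algebra.Group"
begin

unbundle cardinal_syntax

section \<open>Many-sorted first-order logic\<close>

text \<open>
  Bound and free variables are de Bruijn indices; \<open>Ex s \<phi>\<close> binds index \<open>0\<close> of \<open>\<phi>\<close>, ranging over
  the sort \<open>s\<close>. Elements \<open>a\<close> of the structure may occur as parameters \<open>Par a\<close>, and
  \<open>params \<phi>\<close> is the set of parameters of \<open>\<phi>\<close>.
\<close>

datatype ('f, params_tm: 'a) tm = Var nat | Par 'a | Fn 'f "('f, 'a) tm list"

datatype ('f, 'r, 's, params: 'a) fm =
    Eq "('f, 'a) tm" "('f, 'a) tm"
  | Rel 'r "('f, 'a) tm list"
  | Neg "('f, 'r, 's, 'a) fm"
  | And "('f, 'r, 's, 'a) fm" "('f, 'r, 's, 'a) fm"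
  | Ex 's "('f, 'r, 's, 'a) fm"

abbreviation Or :: "('f, 'r, 's, 'a) fm \<Rightarrow> ('f, 'r, 's, 'a) fm \<Rightarrow> ('f, 'r, 's, 'a) fm" where
  "Or \<phi> \<psi> \<equiv> Neg (And (Neg \<phi>) (Neg \<psi>))"

text \<open>
  A language: the function and relation symbols are those with a signature. The language has a
  distinguished sort \<open>gsort\<close> and a binary function symbol \<open>mul\<close> on it;
  identity and inverse are definable from \<open>mul\<close> and need not be symbols.
\<close>

record ('f, 'r, 's) lang =
  fsig :: "'f \<Rightarrow> ('s list \<times> 's) option"
  rsig :: "'r \<Rightarrow> 's list option"
  gsort :: 's
  mul :: 'f

text \<open>
  A structure: its universe is the whole type \<open>'a\<close>, and every element has exactly one sort.
\<close>

record ('f, 'r, 's, 'a) fo_struct = "('f, 'r, 's) lang" +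
  sort_of :: "'a \<Rightarrow> 's"
  fint :: "'f \<Rightarrow> 'a list \<Rightarrow> 'a"
  rint :: "'r \<Rightarrow> 'a list \<Rightarrow> bool"

definition is_fo_struct :: "('f, 'r, 's, 'a) fo_struct \<Rightarrow> bool" where
  "is_fo_struct M \<longleftrightarrow> fsig M (mul M) = Some ([gsort M, gsort M], gsort M) \<and>
     (\<forall>f ss s as. fsig M f = Some (ss, s) \<and> map (sort_of M) as = ss \<longrightarrow> sort_of M (fint M f as) = s)"

text \<open>
  Well-sortedness in a context \<open>\<Gamma>\<close> that lists the sorts of the free variables;
  \<open>tm_sort\<close> returns \<open>None\<close> on ill-sorted terms.
\<close>

primrec tm_sort :: "('f, 'r, 's, 'a) fo_struct \<Rightarrow> 's list \<Rightarrow> ('f, 'a) tm \<Rightarrow> 's option" where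
  "tm_sort M \<Gamma> (Var i) = (if i < length \<Gamma> then Some (\<Gamma> ! i) else None)"
| "tm_sort M \<Gamma> (Par a) = Some (sort_of M a)"
| "tm_sort M \<Gamma> (Fn f ts) = (case fsig M f of None \<Rightarrow> None
     | Some (ss, s) \<Rightarrow> if map (tm_sort M \<Gamma>) ts = map Some ss then Some s else None)"

primrec wf_fm :: "('f, 'r, 's, 'a) fo_struct \<Rightarrow> 's list \<Rightarrow> ('f, 'r, 's, 'a) fm \<Rightarrow> bool" where
  "wf_fm M \<Gamma> (Eq t u) \<longleftrightarrow> tm_sort M \<Gamma> t \<noteq> None \<and> tm_sort M \<Gamma> t = tm_sort M \<Gamma> u"
| "wf_fm M \<Gamma> (Rel r ts) \<longleftrightarrow> (\<exists>ss. rsig M r = Some ss \<and> map (tm_sort M \<Gamma>) ts = map Some ss)"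
| "wf_fm M \<Gamma> (Neg \<phi>) \<longleftrightarrow> wf_fm M \<Gamma> \<phi>"
| "wf_fm M \<Gamma> (And \<phi> \<psi>) \<longleftrightarrow> wf_fm M \<Gamma> \<phi> \<and> wf_fm M \<Gamma> \<psi>"
| "wf_fm M \<Gamma> (Ex s \<phi>) \<longleftrightarrow> wf_fm M (s # \<Gamma>) \<phi>"

primrec tm_val :: "('f, 'r, 's, 'a) fo_struct \<Rightarrow> 'a list \<Rightarrow> ('f, 'a) tm \<Rightarrow> 'a" where
  "tm_val M e (Var i) = e ! i"
| "tm_val M e (Par a) = a"
| "tm_val M e (Fn f ts) = fint M f (map (tm_val M e) ts)"

text \<open>
  Satisfaction in the substructure of \<open>M\<close> with universe \<open>U\<close>; \<open>U = UNIV\<close> gives satisfaction in \<open>M\<close>.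
\<close>

primrec sat :: "('f, 'r, 's, 'a) fo_struct \<Rightarrow> 'a set \<Rightarrow> 'a list \<Rightarrow> ('f, 'r, 's, 'a) fm \<Rightarrow> bool" where
  "sat M U e (Eq t u) \<longleftrightarrow> tm_val M e t = tm_val M e u"
| "sat M U e (Rel r ts) \<longleftrightarrow> rint M r (map (tm_val M e) ts)"
| "sat M U e (Neg \<phi>) \<longleftrightarrow> \<not> sat M U e \<phi>"
| "sat M U e (And \<phi> \<psi>) \<longleftrightarrow> sat M U e \<phi> \<and> sat M U e \<psi>"
| "sat M U e (Ex s \<phi>) \<longleftrightarrow> (\<exists>a\<in>U. sort_of M a = s \<and> sat M U (a # e) \<phi>)"

definition elementary_substruct :: "('f, 'r, 's, 'a) fo_struct \<Rightarrow> 'a set \<Rightarrow> bool" where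
  "elementary_substruct M N \<longleftrightarrow>
     (\<forall>f ss s as. fsig M f = Some (ss, s) \<and> map (sort_of M) as = ss \<and> set as \<subseteq> N \<longrightarrow> fint M f as \<in> N) \<and>
     (\<forall>\<phi> e. wf_fm M (map (sort_of M) e) \<phi> \<and> params \<phi> = {} \<and> set e \<subseteq> N \<longrightarrow>
        sat M N e \<phi> = sat M UNIV e \<phi>)"

text \<open>Formulas over \<open>A\<close> in one free variable, of sort \<open>s\<close>; \<open>Lx\<close> is the case of the group sort.\<close>

definition L1 :: "('f, 'r, 's, 'a) fo_struct \<Rightarrow> 's \<Rightarrow> 'a set \<Rightarrow> ('f, 'r, 's, 'a) fm set" where
  "L1 M s A = {\<phi>. wf_fm M [s] \<phi> \<and> params \<phi> \<subseteq> A}"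

abbreviation Lx :: "('f, 'r, 's, 'a) fo_struct \<Rightarrow> 'a set \<Rightarrow> ('f, 'r, 's, 'a) fm set" where
  "Lx M A \<equiv> L1 M (gsort M) A"

definition sol :: "('f, 'r, 's, 'a) fo_struct \<Rightarrow> ('f, 'r, 's, 'a) fm \<Rightarrow> 'a set" where
  "sol M \<phi> = {a. sort_of M a = gsort M \<and> sat M UNIV [a] \<phi>}"

definition sols :: "('f, 'r, 's, 'a) fo_struct \<Rightarrow> ('f, 'r, 's, 'a) fm set \<Rightarrow> 'a set" where
  "sols M p = {a. sort_of M a = gsort M \<and> (\<forall>\<phi>\<in>p. sat M UNIV [a] \<phi>)}"

section \<open>Monster models of theories expanding a group\<close>

definition is_small :: "'k rel \<Rightarrow> 'a set \<Rightarrow> bool" where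
  "is_small \<kappa> A \<longleftrightarrow> |A| <o \<kappa>"

definition saturated :: "'k rel \<Rightarrow> ('f, 'r, 's, 'a) fo_struct \<Rightarrow> bool" where
  "saturated \<kappa> M \<longleftrightarrow> (\<forall>A s p. is_small \<kappa> A \<and> p \<subseteq> L1 M s A \<and>
     (\<forall>F. finite F \<and> F \<subseteq> p \<longrightarrow> (\<exists>a. sort_of M a = s \<and> (\<forall>\<phi>\<in>F. sat M UNIV [a] \<phi>))) \<longrightarrow>
     (\<exists>a. sort_of M a = s \<and> (\<forall>\<phi>\<in>p. sat M UNIV [a] \<phi>)))"

definition grp :: "('f, 'r, 's, 'a) fo_struct \<Rightarrow> 'a monoid" where
  "grp M = \<lparr>carrier = {a. sort_of M a = gsort M},
     monoid.mult = (\<lambda>a b. fint M (mul M) [a, b]),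
     one = (THE e. sort_of M e = gsort M \<and>
       (\<forall>a. sort_of M a = gsort M \<longrightarrow> fint M (mul M) [e, a] = a \<and> fint M (mul M) [a, e] = a))\<rparr>"

text \<open>
  ``Sufficiently saturated'' is read as \<open>\<kappa>\<close>-saturated for a cardinal \<open>\<kappa> > |L|\<close>, with small meaning
  of cardinality less than \<open>\<kappa>\<close>; \<open>|L|\<close> is the number of \<open>L\<close>-formulas, hence infinite. That \<open>T\<close>
  expands a group enters through its model \<open>M\<close>, in which \<open>mul\<close> is a group operation on \<open>gsort\<close>.
\<close>

definition monster :: "'k rel \<Rightarrow> ('f, 'r, 's, 'a) fm set \<Rightarrow> ('f, 'r, 's, 'a) fo_struct \<Rightarrow> bool" where
  "monster \<kappa> T M \<longleftrightarrow> is_fo_struct M \<and>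
     (\<forall>\<phi>\<in>T. wf_fm M [] \<phi> \<and> params \<phi> = {} \<and> sat M UNIV [] \<phi>) \<and>
     group (grp M) \<and>
     Card_order \<kappa> \<and> |{\<phi> :: ('f, 'r, 's, 'a) fm. params \<phi> = {} \<and> (\<exists>\<Gamma>. wf_fm M \<Gamma> \<phi>)}| <o \<kappa> \<and>
     saturated \<kappa> M"

section \<open>Type spaces and Keisler measures\<close>

definition types :: "('f, 'r, 's, 'a) fo_struct \<Rightarrow> 'a set \<Rightarrow> ('f, 'r, 's, 'a) fm set set" where
  "types M A = {p. p \<subseteq> Lx M A \<and> (\<forall>\<phi>\<in>Lx M A. \<phi> \<in> p \<or> Neg \<phi> \<in> p) \<and>
     (\<forall>F. finite F \<and> F \<subseteq> p \<longrightarrow> sols M F \<noteq> {})}"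

definition type_space ::
    "('f, 'r, 's, 'a) fo_struct \<Rightarrow> 'a set \<Rightarrow> ('f, 'r, 's, 'a) fm set topology" where
  "type_space M A = topology_generated_by ((\<lambda>\<phi>. {p \<in> types M A. \<phi> \<in> p}) ` Lx M A)"

definition borel_sigma :: "'b topology \<Rightarrow> 'b measure" where
  "borel_sigma X = sigma (topspace X) {U. openin X U}"

definition regular_borel_measure :: "'b topology \<Rightarrow> 'b measure \<Rightarrow> bool" where
  "regular_borel_measure X P \<longleftrightarrow> sets P = sets (borel_sigma X) \<and>
     (\<forall>B\<in>sets P.
        emeasure P B = (INF U\<in>{U. openin X U \<and> B \<subseteq> U}. emeasure P U) \<and>
        emeasure P B = (SUP C\<in>{C. compactin X C \<and> C \<subseteq> B}. emeasure P C))"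

text \<open>
  Formulas are not literally taken up to equivalence: a Keisler measure must not distinguish
  equivalent ones. Extensionality makes equality of measures over \<open>A\<close> agreement on \<open>Lx M A\<close>.
\<close>

definition keisler ::
    "('f, 'r, 's, 'a) fo_struct \<Rightarrow> 'a set \<Rightarrow> (('f, 'r, 's, 'a) fm \<Rightarrow> real) set" where
  "keisler M A = {\<mu> \<in> extensional (Lx M A).
     (\<forall>\<phi>\<in>Lx M A. 0 \<le> \<mu> \<phi>) \<and>
     (\<forall>\<phi>\<in>Lx M A. \<forall>\<psi>\<in>Lx M A. sol M \<phi> = sol M \<psi> \<longrightarrow> \<mu> \<phi> = \<mu> \<psi>) \<and>
     (\<forall>\<phi>\<in>Lx M A. sol M \<phi> = carrier (grp M) \<longrightarrow> \<mu> \<phi> = 1) \<and>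
     (\<forall>\<phi>\<in>Lx M A. \<forall>\<psi>\<in>Lx M A. sol M (And \<phi> \<psi>) = {} \<longrightarrow> \<mu> (Or \<phi> \<psi>) = \<mu> \<phi> + \<mu> \<psi>)}"

definition restr :: "('f, 'r, 's, 'a) fo_struct \<Rightarrow> 'a set \<Rightarrow>
    (('f, 'r, 's, 'a) fm \<Rightarrow> real) \<Rightarrow> ('f, 'r, 's, 'a) fm \<Rightarrow> real" where
  "restr M A \<mu> = restrict \<mu> (Lx M A)"

definition supp :: "('f, 'r, 's, 'a) fo_struct \<Rightarrow> 'a set \<Rightarrow>
    (('f, 'r, 's, 'a) fm \<Rightarrow> real) \<Rightarrow> ('f, 'r, 's, 'a) fm set set" where
  "supp M A \<mu> = {p \<in> types M A. \<forall>\<phi>\<in>p. \<mu> \<phi> > 0}"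

text \<open>The regular Borel probability measure on the type space identified with \<open>\<mu>\<close>.\<close>

definition borel_ext :: "('f, 'r, 's, 'a) fo_struct \<Rightarrow> 'a set \<Rightarrow>
    (('f, 'r, 's, 'a) fm \<Rightarrow> real) \<Rightarrow> ('f, 'r, 's, 'a) fm set measure" where
  "borel_ext M A \<mu> = (THE P. regular_borel_measure (type_space M A) P \<and>
     (\<forall>\<phi>\<in>Lx M A. emeasure P {p \<in> types M A. \<phi> \<in> p} = ennreal (\<mu> \<phi>)))"

text \<open>\<open>\<mu>(H(x))\<close> for a Keisler measure over the monster and a partial type \<open>H\<close>.\<close>

definition ptype_measure :: "('f, 'r, 's, 'a) fo_struct \<Rightarrow>
    (('f, 'r, 's, 'a) fm \<Rightarrow> real) \<Rightarrow> ('f, 'r, 's, 'a) fm set \<Rightarrow> real" where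
  "ptype_measure M \<mu> H = measure (borel_ext M UNIV \<mu>) {p \<in> types M UNIV. H \<subseteq> p}"

section \<open>Definable amenability\<close>

text \<open>
  \<open>rtrans_fm M d 0 \<phi>\<close> is \<open>\<phi>(x \<cdot> d)\<close>. The index \<open>k\<close> is the name of \<open>x\<close> below \<open>k\<close> quantifiers; since \<open>x\<close>
  is replaced by a term in \<open>x\<close> itself, no shifting of other variables is needed.
\<close>

primrec rtrans_tm :: "('f, 'r, 's, 'a) fo_struct \<Rightarrow> 'a \<Rightarrow> nat \<Rightarrow> ('f, 'a) tm \<Rightarrow> ('f, 'a) tm" where
  "rtrans_tm M d k (Var i) = (if i = k then Fn (mul M) [Var k, Par d] else Var i)"
| "rtrans_tm M d k (Par a) = Par a"
| "rtrans_tm M d k (Fn f ts) = Fn f (map (rtrans_tm M d k) ts)"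

primrec rtrans_fm ::
    "('f, 'r, 's, 'a) fo_struct \<Rightarrow> 'a \<Rightarrow> nat \<Rightarrow> ('f, 'r, 's, 'a) fm \<Rightarrow> ('f, 'r, 's, 'a) fm" where
  "rtrans_fm M d k (Eq t u) = Eq (rtrans_tm M d k t) (rtrans_tm M d k u)"
| "rtrans_fm M d k (Rel r ts) = Rel r (map (rtrans_tm M d k) ts)"
| "rtrans_fm M d k (Neg \<phi>) = Neg (rtrans_fm M d k \<phi>)"
| "rtrans_fm M d k (And \<phi> \<psi>) = And (rtrans_fm M d k \<phi>) (rtrans_fm M d k \<psi>)"
| "rtrans_fm M d k (Ex s \<phi>) = Ex s (rtrans_fm M d (Suc k) \<phi>)"

abbreviation rtrans ::
    "('f, 'r, 's, 'a) fo_struct \<Rightarrow> 'a \<Rightarrow> ('f, 'r, 's, 'a) fm \<Rightarrow> ('f, 'r, 's, 'a) fm" where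
  "rtrans M d \<phi> \<equiv> rtrans_fm M d 0 \<phi>"

definition type_definable_subgroup ::
    "'k rel \<Rightarrow> ('f, 'r, 's, 'a) fo_struct \<Rightarrow> ('f, 'r, 's, 'a) fm set \<Rightarrow> bool" where
  "type_definable_subgroup \<kappa> M H \<longleftrightarrow>
     (\<exists>A. is_small \<kappa> A \<and> H \<subseteq> Lx M A) \<and> subgroup (sols M H) (grp M)"

definition right_invariant :: "('f, 'r, 's, 'a) fo_struct \<Rightarrow> ('f, 'r, 's, 'a) fm set \<Rightarrow>
    (('f, 'r, 's, 'a) fm \<Rightarrow> real) \<Rightarrow> bool" where
  "right_invariant M H \<mu> \<longleftrightarrow> ptype_measure M \<mu> H = 1 \<and>
     (\<forall>\<phi>\<in>Lx M UNIV. \<forall>a\<in>sols M H. \<mu> \<phi> = \<mu> (rtrans M a \<phi>))"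

definition definably_amenable ::
    "('f, 'r, 's, 'a) fo_struct \<Rightarrow> ('f, 'r, 's, 'a) fm set \<Rightarrow> bool" where
  "definably_amenable M H \<longleftrightarrow> (\<exists>\<mu>\<in>keisler M UNIV. right_invariant M H \<mu>)"

section \<open>Convolution\<close>

text \<open>
  The common value \<open>F(q)\<close> of \<open>\<mu>(\<phi>(x \<cdot> d))\<close> over all \<open>d \<Turnstile> q\<close>. Types in the variable \<open>y\<close> are types in the
  single free variable, so that \<open>\<nu>\<close> viewed in the variable \<open>y\<close> is \<open>\<nu>\<close> itself.
\<close>

definition fibre :: "('f, 'r, 's, 'a) fo_struct \<Rightarrow> (('f, 'r, 's, 'a) fm \<Rightarrow> real) \<Rightarrow>
    ('f, 'r, 's, 'a) fm \<Rightarrow> ('f, 'r, 's, 'a) fm set \<Rightarrow> real" where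
  "fibre M \<mu> \<phi> q = (THE r. \<exists>d\<in>sols M q. r = \<mu> (rtrans M d \<phi>))"

definition star_model :: "'k rel \<Rightarrow> ('f, 'r, 's, 'a) fo_struct \<Rightarrow> (('f, 'r, 's, 'a) fm \<Rightarrow> real) \<Rightarrow>
    (('f, 'r, 's, 'a) fm \<Rightarrow> real) \<Rightarrow> ('f, 'r, 's, 'a) fm \<Rightarrow> 'a set \<Rightarrow> bool" where
  "star_model \<kappa> M \<mu> \<nu> \<phi> N \<longleftrightarrow> is_small \<kappa> N \<and> elementary_substruct M N \<and> params \<phi> \<subseteq> N \<and>
     (\<forall>q\<in>supp M N (restr M N \<nu>). \<forall>d\<in>sols M q. \<forall>d'\<in>sols M q.
        \<mu> (rtrans M d \<phi>) = \<mu> (rtrans M d' \<phi>)) \<and>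
     fibre M \<mu> \<phi> \<in> borel_measurable
       (borel_sigma (subtopology (type_space M N) (supp M N (restr M N \<nu>))))"

definition star_Borel :: "'k rel \<Rightarrow> ('f, 'r, 's, 'a) fo_struct \<Rightarrow>
    (('f, 'r, 's, 'a) fm \<Rightarrow> real) \<Rightarrow> (('f, 'r, 's, 'a) fm \<Rightarrow> real) \<Rightarrow> bool" where
  "star_Borel \<kappa> M \<mu> \<nu> \<longleftrightarrow> (\<forall>\<phi>\<in>Lx M UNIV. \<exists>N. star_model \<kappa> M \<mu> \<nu> \<phi> N)"

text \<open>\<open>(\<mu> * \<nu>)(\<phi>)\<close> is the integral computed with any admissible \<open>N\<close>; it does not depend on \<open>N\<close>.\<close>

definition convolution :: "'k rel \<Rightarrow> ('f, 'r, 's, 'a) fo_struct \<Rightarrow> (('f, 'r, 's, 'a) fm \<Rightarrow> real) \<Rightarrow>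
    (('f, 'r, 's, 'a) fm \<Rightarrow> real) \<Rightarrow> ('f, 'r, 's, 'a) fm \<Rightarrow> real" where
  "convolution \<kappa> M \<mu> \<nu> = (\<lambda>\<phi>\<in>Lx M UNIV. THE r. \<forall>N. star_model \<kappa> M \<mu> \<nu> \<phi> N \<longrightarrow>
     r = (\<integral>q. fibre M \<mu> \<phi> q
       \<partial>(restrict_space (borel_ext M N (restr M N \<nu>)) (supp M N (restr M N \<nu>)))))"

definition keisler_idempotent ::
    "'k rel \<Rightarrow> ('f, 'r, 's, 'a) fo_struct \<Rightarrow> (('f, 'r, 's, 'a) fm \<Rightarrow> real) \<Rightarrow> bool" where
  "keisler_idempotent \<kappa> M \<mu> \<longleftrightarrow> star_Borel \<kappa> M \<mu> \<mu> \<and> convolution \<kappa> M \<mu> \<mu> = \<mu>"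

end

theory Submission
  imports Defs
begin

text \<open>
  Invariance makes the fibre function of \<open>\<mu> * \<nu>\<close> constant. If \<open>\<nu>\<close> is concentrated on \<open>H\<close>, every
  formula of \<open>H\<close> has \<open>\<nu>\<close>-measure \<open>1\<close>, so over a model \<open>N\<close> that contains the parameters of \<open>H\<close> a type
  in the support of \<open>\<nu>|N\<close> contains \<open>H\<close>: all its realisations \<open>d\<close> lie in the subgroup, where
  \<open>\<mu>(\<phi>(x \<cdot> d)) = \<mu>(\<phi>(x))\<close>. A constant function is Borel, and its integral is \<open>\<mu>(\<phi>)\<close> because the support
  has measure \<open>1\<close>. Idempotence is the case \<open>\<nu> = \<mu>\<close>.

  The value of the convolution may be computed with any admissible model \<open>N\<close>, also one
  that misses the parameters of \<open>H\<close>. This independence needs no comparison of models: a type \<open>q\<close> in the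
  support of \<open>\<nu>|N\<close> consists of formulas of positive measure, which \<open>H\<close>, being of measure \<open>1\<close>, cannot
  contradict. By saturation some realisation of \<open>q\<close> lies in the subgroup
  (\<open>supp_type_realised_in_H\<close>), and since admissibility of \<open>N\<close> says that all realisations of \<open>q\<close> give the
  same value, that value is \<open>\<mu>(\<phi>)\<close> (\<open>fibre_eq\<close>).

  Three general facts support this. A Keisler measure has exactly one regular Borel extension to
  the type space (\<open>ex1_regular_extension\<close>), so that the measure of a partial type and the
  integral mean what they should; type spaces need not be metrizable, hence the extension is built
  as an outer measure from inner approximation of open sets by clopen ones. The support of a Keisler
  measure has full measure (\<open>supp_full_measure\<close>), by compactness. Every small set lies in a small
  elementary submodel (\<open>small_elementary_extension\<close>), by the downward Loewenheim-Skolem construction.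
\<close>

section \<open>Regular Borel extension of a content on clopen sets\<close>

text \<open>
  The model case is the Stone space of a Boolean algebra: a finitely additive measure on the algebra
  is one on its clopen sets.
\<close>

locale clopen_content = algebra "topspace X" B for X :: "'b topology" and B :: "'b set set" +
  fixes m :: "'b set \<Rightarrow> ennreal"
  assumes compact: "compact_space X"
    and base_open: "b \<in> B \<Longrightarrow> openin X b"
    and base: "openin X U \<Longrightarrow> x \<in> U \<Longrightarrow> \<exists>b\<in>B. x \<in> b \<and> b \<subseteq> U"
    and m_positive: "positive B m"
    and m_additive: "additive B m"
    and m_finite: "m (topspace X) < \<infinity>"
begin

lemma m_mono: "a \<in> B \<Longrightarrow> b \<in> B \<Longrightarrow> a \<subseteq> b \<Longrightarrow> m a \<le> m b"
  using additive_increasing[OF m_positive m_additive] by (auto simp: increasing_def)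

lemma m_add: "a \<in> B \<Longrightarrow> b \<in> B \<Longrightarrow> a \<inter> b = {} \<Longrightarrow> m (a \<union> b) = m a + m b"
  using m_additive by (auto simp: additive_def)

lemma base_closed: "b \<in> B \<Longrightarrow> closedin X b"
  using base_open[of "topspace X - b"] sets_into_space
  by (auto simp: closedin_def)

lemma base_compact: "b \<in> B \<Longrightarrow> compactin X b"
  by (intro closedin_compact_space compact base_closed)

text \<open>
  Compactness lets a cover by arbitrary open sets be refined to a finite one by members of \<open>B\<close>,
  on which \<open>m\<close> is defined and finitely subadditive.
\<close>

lemma compact_cover_base:
  assumes C: "compactin X C" and U: "\<And>U. U \<in> \<U> \<Longrightarrow> openin X U" "C \<subseteq> \<Union>\<U>"
  shows "\<exists>F. finite F \<and> F \<subseteq> B \<and> C \<subseteq> \<Union>F \<and> (\<forall>b\<in>F. \<exists>U\<in>\<U>. b \<subseteq> U)"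
proof -
  let ?V = "{b\<in>B. \<exists>U\<in>\<U>. b \<subseteq> U}"
  have "C \<subseteq> \<Union>?V"
  proof
    fix x assume "x \<in> C"
    then obtain W where W: "W \<in> \<U>" "x \<in> W" using U(2) by auto
    then obtain b where "b \<in> B" "x \<in> b" "b \<subseteq> W" using base[OF U(1)[OF W(1)] W(2)] by auto
    with W(1) show "x \<in> \<Union>?V" by blast
  qed
  moreover have "\<forall>b\<in>?V. openin X b"
    using base_open by auto
  ultimately obtain F where "finite F" "F \<subseteq> ?V" "C \<subseteq> \<Union>F"
    using C[unfolded compactin_def, THEN conjunct2, rule_format, of ?V] by blast
  then show ?thesis
    by (intro exI[of _ F]) auto
qed

lemma compact_in_open_clopen:
  assumes "compactin X C" "openin X U" "C \<subseteq> U"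
  obtains b where "b \<in> B" "C \<subseteq> b" "b \<subseteq> U"
proof -
  have "\<exists>F. finite F \<and> F \<subseteq> B \<and> C \<subseteq> \<Union>F \<and> (\<forall>b\<in>F. \<exists>U'\<in>{U}. b \<subseteq> U')"
    using assms by (intro compact_cover_base) auto
  then obtain F where F: "finite F" "F \<subseteq> B" "C \<subseteq> \<Union>F" "\<And>b. b \<in> F \<Longrightarrow> b \<subseteq> U"
    by auto
  show ?thesis
    by (rule that[of "\<Union>F"]) (use F in auto)
qed

text \<open>
  The sigma-algebra generated by \<open>B\<close> may be smaller than the Borel one, so that extending \<open>m\<close> by
  Caratheodory's theorem from countable covers in \<open>B\<close> is not enough. Open sets are measured from
  inside by \<open>B\<close>, and arbitrary sets from outside by open sets; outer regularity then
  holds by construction.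
\<close>

definition open_content :: "'b set \<Rightarrow> ennreal" where
  "open_content U = (SUP C\<in>{C\<in>B. C \<subseteq> U}. m C)"

definition outer_content :: "'b set \<Rightarrow> ennreal" where
  "outer_content A = (INF U\<in>{U. openin X U \<and> A \<subseteq> U}. open_content U)"

lemma le_open_content: "C \<in> B \<Longrightarrow> C \<subseteq> U \<Longrightarrow> m C \<le> open_content U"
  unfolding open_content_def by (rule SUP_upper) auto

lemma open_content_mono: "U \<subseteq> V \<Longrightarrow> open_content U \<le> open_content V"
  unfolding open_content_def by (rule SUP_subset_mono) auto

lemma open_content_base:
  assumes "b \<in> B" shows "open_content b = m b"
proof (rule antisym)
  show "open_content b \<le> m b"
    unfolding open_content_def by (rule SUP_least) (use assms m_mono in blast)
qed (rule le_open_content[OF assms subset_refl])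

lemma outer_content_le: "openin X U \<Longrightarrow> A \<subseteq> U \<Longrightarrow> outer_content A \<le> open_content U"
  unfolding outer_content_def by (rule INF_lower) auto

lemma outer_content_open:
  assumes "openin X U" shows "outer_content U = open_content U"
proof (rule antisym)
  show "open_content U \<le> outer_content U"
    unfolding outer_content_def by (rule INF_greatest) (use open_content_mono in blast)
qed (rule outer_content_le[OF assms subset_refl])

lemma outer_content_mono: "A \<subseteq> A' \<Longrightarrow> outer_content A \<le> outer_content A'"
  unfolding outer_content_def by (rule INF_superset_mono) auto

text \<open>
  A clopen subset of the union is covered by finitely many members of \<open>B\<close>, each inside one of the
  \<open>U i\<close>; grouping them by \<open>i\<close> yields one clopen subset of each of finitely many \<open>U i\<close>.
\<close>

lemma open_content_UN:
  fixes U :: "nat \<Rightarrow> 'b set"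
  assumes U: "\<And>i. openin X (U i)"
  shows "open_content (\<Union>i. U i) \<le> (\<Sum>i. open_content (U i))"
  unfolding open_content_def[of "\<Union>i. U i"]
proof (rule SUP_least)
  fix C assume "C \<in> {C \<in> B. C \<subseteq> (\<Union>i. U i)}"
  then have C: "C \<in> B" "C \<subseteq> \<Union>(range U)" by auto
  have "\<exists>F. finite F \<and> F \<subseteq> B \<and> C \<subseteq> \<Union>F \<and> (\<forall>b\<in>F. \<exists>V\<in>range U. b \<subseteq> V)"
    using C U by (intro compact_cover_base base_compact) auto
  then obtain F where F: "finite F" "F \<subseteq> B" "C \<subseteq> \<Union>F"
    and "\<forall>b\<in>F. \<exists>i. b \<subseteq> U i" by auto
  then obtain k where k: "\<And>b. b \<in> F \<Longrightarrow> b \<subseteq> U (k b)"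
    by metis
  \<comment> \<open>the grouping: a bound by single members of \<open>F\<close> would count each \<open>U i\<close> too often\<close>
  define b where "b i = \<Union>{c\<in>F. k c = i}" for i
  have b: "b i \<in> B" "b i \<subseteq> U i" for i
    using F k by (auto simp: b_def)
  have "C \<subseteq> (\<Union>i\<in>k ` F. b i)"
    using F(3) unfolding b_def by blast
  then have "m C \<le> m (\<Union>i\<in>k ` F. b i)"
    using F(1) b(1) C(1) by (intro m_mono finite_UN) auto
  also have "\<dots> \<le> (\<Sum>i\<in>k ` F. m (b i))"
    using F b by (intro subadditive m_positive m_additive) auto
  also have "\<dots> \<le> (\<Sum>i\<in>k ` F. open_content (U i))"
    by (intro sum_mono le_open_content b)
  also have "\<dots> \<le> (\<Sum>i. open_content (U i))"
    using F by (intro sum_le_suminf summableI) auto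
  finally show "m C \<le> (\<Sum>i. open_content (U i))" .
qed

text \<open>
  Approximate each \<open>A i\<close> by an open set up to an error \<open>e / 2 ^ (i + 1)\<close>.
\<close>

lemma outer_content_UN:
  fixes A :: "nat \<Rightarrow> 'b set"
  shows "outer_content (\<Union>i. A i) \<le> (\<Sum>i. outer_content (A i))"
proof (rule ennreal_le_epsilon)
  fix e :: real assume fin: "(\<Sum>i. outer_content (A i)) < top_class.top" and e: "0 < e"
  have "\<exists>U. openin X U \<and> A i \<subseteq> U \<and> open_content U \<le> outer_content (A i) + ennreal (e * (1/2)^Suc i)" for i
  proof -
    have "outer_content (A i) \<le> (\<Sum>i. outer_content (A i))"
      using sum_le_suminf[of "\<lambda>i. outer_content (A i)" "{i}"] by (simp add: summableI)
    then have "outer_content (A i) < outer_content (A i) + ennreal (e * (1/2)^Suc i)"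
      using fin e by (cases "outer_content (A i)") (auto simp flip: ennreal_plus simp: ennreal_less_iff)
    then have "\<exists>U\<in>{U. openin X U \<and> A i \<subseteq> U}.
        open_content U < outer_content (A i) + ennreal (e * (1/2)^Suc i)"
      unfolding outer_content_def[of "A i"] by (rule INF_less_iff[THEN iffD1])
    then show ?thesis by (blast intro: less_imp_le)
  qed
  then obtain U where U: "\<And>i. openin X (U i)" "\<And>i. A i \<subseteq> U i"
     "\<And>i. open_content (U i) \<le> outer_content (A i) + ennreal (e * (1/2)^Suc i)" by metis
  have "outer_content (\<Union>i. A i) \<le> open_content (\<Union>i. U i)"
    using U by (intro outer_content_le openin_Union) auto
  also have "\<dots> \<le> (\<Sum>i. open_content (U i))"
    by (rule open_content_UN) fact
  also have "\<dots> \<le> (\<Sum>i. outer_content (A i) + ennreal (e * (1/2)^Suc i))"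
    by (intro suminf_le summableI U)
  also have "\<dots> = (\<Sum>i. outer_content (A i)) + (\<Sum>i. ennreal (e * (1/2)^Suc i))"
    by (intro suminf_add[symmetric] summableI)
  also have "(\<Sum>i. ennreal (e * (1/2)^Suc i)) = ennreal e"
  proof -
    have "(\<lambda>i. e * (1/2)^Suc i) sums (e * 1)"
      by (intro sums_mult power_half_series)
    then show ?thesis
      using e by (subst suminf_ennreal2) (auto simp: sums_iff)
  qed
  finally show "outer_content (\<Union>i. A i) \<le> (\<Sum>i. outer_content (A i)) + ennreal e" .
qed

lemma outer_measure_outer_content:
  "outer_measure_space (Pow (topspace X)) outer_content"
proof -
  have "outer_content {} = 0"
    using outer_content_open[of "{}"] open_content_base[of "{}"] m_positive
    by (simp add: positive_def)
  then show ?thesis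
    using outer_content_UN outer_content_mono
    by (auto simp: outer_measure_space_def positive_def increasing_def countably_subadditive_def)
qed

text \<open>
  If \<open>V\<close> is an open cover of the test set \<open>E\<close>, then \<open>V \<inter> U\<close> is exhausted by clopen sets \<open>C\<close>, and \<open>V - C\<close> is
  again open because \<open>C\<close> is closed; so \<open>V\<close> splits additively along \<open>C\<close>, and the supremum over \<open>C\<close>
  gives the splitting of \<open>E\<close> along \<open>U\<close>.
\<close>

lemma open_in_lambda_system:
  assumes U: "openin X U"
  shows "U \<in> lambda_system (topspace X) (Pow (topspace X)) outer_content"
proof -
  interpret P: sigma_algebra "topspace X" "Pow (topspace X)" by (rule sigma_algebra_Pow)
  have split: "outer_content (E \<inter> U) + outer_content (E - U) \<le> open_content V"
    if V: "openin X V" "E \<subseteq> V" for E V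
  proof -
    have "m C + outer_content (E - U) \<le> open_content V" if C: "C \<in> B" "C \<subseteq> V \<inter> U" for C
    proof -
      have "outer_content (E - U) \<le> open_content (V - C)"
        using V C base_closed by (intro outer_content_le openin_diff) auto
      then have "m C + outer_content (E - U) \<le> m C + open_content (V - C)"
        by (rule add_left_mono)
      also have "\<dots> = (SUP D\<in>{D\<in>B. D \<subseteq> V - C}. m C + m D)"
        unfolding open_content_def by (rule ennreal_SUP_add_right) auto
      also have "\<dots> \<le> open_content V"
      proof (rule SUP_least)
        fix D assume D: "D \<in> {D \<in> B. D \<subseteq> V - C}"
        then have "m C + m D = m (C \<union> D)"
          using C by (intro m_add[symmetric]) auto
        also have "\<dots> \<le> open_content V"
          using C D by (intro le_open_content) auto
        finally show "m C + m D \<le> open_content V" .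
      qed
      finally show ?thesis .
    qed
    then have "open_content (V \<inter> U) + outer_content (E - U) \<le> open_content V"
      unfolding open_content_def[of "V \<inter> U"]
      by (subst ennreal_SUP_add_left[symmetric]) (auto intro!: SUP_least)
    moreover have "outer_content (E \<inter> U) \<le> open_content (V \<inter> U)"
      using V U by (intro outer_content_le) auto
    ultimately show ?thesis
      using add_right_mono order_trans by blast
  qed
  have "outer_content (E \<inter> U) + outer_content (E - U) \<le> outer_content E" for E
    unfolding outer_content_def[of E] using split by (auto intro!: INF_greatest)
  moreover have "outer_content E \<le> outer_content (E \<inter> U) + outer_content (E - U)"
    if "E \<subseteq> topspace X" for E
  proof -
    have "subadditive (Pow (topspace X)) outer_content"
      using outer_measure_outer_content P.countably_subadditive_subadditive
      by (auto simp: outer_measure_space_def)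
    from subadditiveD[OF this, of "E \<inter> U" "E - U"] that show ?thesis
      by (auto simp: Int_Diff_Un)
  qed
  ultimately show ?thesis
    using openin_subset[OF U] by (auto simp: P.lambda_system_eq intro!: antisym)
qed

definition content_measure :: "'b measure" where
  "content_measure = measure_of (topspace X) {U. openin X U} outer_content"

lemma sets_content_measure: "sets content_measure = sets (borel_sigma X)"
  unfolding content_measure_def borel_sigma_def by (simp add: openin_subset sets_measure_of_conv)

lemma space_content_measure: "space content_measure = topspace X"
  unfolding content_measure_def by (simp add: space_measure_of_conv)

lemma openin_content_measure: "openin X U \<Longrightarrow> U \<in> sets content_measure"
  unfolding content_measure_def by (subst sets_measure_of) (auto dest: openin_subset)

lemma emeasure_content_measure:
  assumes "A \<in> sets content_measure"
  shows "emeasure content_measure A = outer_content A"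
proof (rule emeasure_measure_of[OF content_measure_def])
  interpret P: sigma_algebra "topspace X" "Pow (topspace X)" by (rule sigma_algebra_Pow)
  let ?L = "lambda_system (topspace X) (Pow (topspace X)) outer_content"
  have ms: "measure_space (topspace X) ?L outer_content"
    by (rule P.caratheodory_lemma[OF outer_measure_outer_content])
  then interpret L: sigma_algebra "topspace X" ?L by (simp add: measure_space_def)
  have eq: "sets content_measure = sigma_sets (topspace X) {U. openin X U}"
    unfolding content_measure_def by (rule sets_measure_of) (auto dest: openin_subset)
  have sub: "sets content_measure \<subseteq> ?L"
    unfolding eq by (rule L.sigma_sets_subset) (auto intro: open_in_lambda_system)
  show "positive (sets content_measure) outer_content"
    using ms sub by (auto simp: measure_space_def positive_def)
  show "countably_additive (sets content_measure) outer_content"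
    using ms sub unfolding measure_space_def countably_additive_def by blast
qed (use assms openin_subset in auto)

lemma emeasure_content_measure_open:
  "openin X U \<Longrightarrow> emeasure content_measure U = open_content U"
  by (simp add: emeasure_content_measure openin_content_measure outer_content_open)

lemma emeasure_content_measure_base: "b \<in> B \<Longrightarrow> emeasure content_measure b = m b"
  by (simp add: emeasure_content_measure_open base_open open_content_base)

lemma finite_measure_content_measure: "finite_measure content_measure"
  by (rule finite_measureI)
     (use emeasure_content_measure_base[OF top] m_finite in \<open>auto simp: space_content_measure\<close>)

text \<open>
  Inner regularity follows from outer regularity of the complement: the measure is finite, and
  complements of open sets are compact.
\<close>

lemma regular_content_measure: "regular_borel_measure X content_measure"
  unfolding regular_borel_measure_def
proof (intro conjI ballI)
  interpret finite_measure content_measure by (rule finite_measure_content_measure)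
  let ?P = "emeasure content_measure"
  have outer: "?P A = (INF U\<in>{U. openin X U \<and> A \<subseteq> U}. ?P U)"
    if "A \<in> sets content_measure" for A
    using that by (auto simp: emeasure_content_measure outer_content_def emeasure_content_measure_open
        intro!: INF_cong)
  fix A assume A: "A \<in> sets content_measure"
  show "?P A = (INF U\<in>{U. openin X U \<and> A \<subseteq> U}. ?P U)" by (rule outer[OF A])
  have Asub: "A \<subseteq> topspace X" using sets.sets_into_space[OF A] by (simp add: space_content_measure)
  show "?P A = (SUP C\<in>{C. compactin X C \<and> C \<subseteq> A}. ?P C)"
  proof (rule antisym)
    show "(SUP C\<in>{C. compactin X C \<and> C \<subseteq> A}. ?P C) \<le> ?P A"
      using A by (auto intro!: SUP_least emeasure_mono)
    show "?P A \<le> (SUP C\<in>{C. compactin X C \<and> C \<subseteq> A}. ?P C)"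
    proof (rule ennreal_le_epsilon)
      fix e :: real assume "0 < e"
      let ?c = "topspace X - A"
      have c: "?c \<in> sets content_measure"
        using A by (metis sets.compl_sets space_content_measure)
      have "?P ?c < ?P ?c + ennreal e"
        using \<open>0 < e\<close> emeasure_finite[of ?c] by (cases "?P ?c") (auto simp flip: ennreal_plus simp: ennreal_less_iff)
      then have "\<exists>U\<in>{U. openin X U \<and> ?c \<subseteq> U}. ?P U < ?P ?c + ennreal e"
        by (subst (asm) (1) outer[OF c]) (rule INF_less_iff[THEN iffD1])
      then obtain U where U: "openin X U" "?c \<subseteq> U" "?P U < ?P ?c + ennreal e" by auto
      let ?K = "topspace X - U"
      have K: "compactin X ?K" "?K \<subseteq> A" "?K \<in> sets content_measure"
        using U Asub openin_content_measure[OF U(1)]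
        by (auto intro!: closedin_compact_space compact simp: sets.compl_sets[of U content_measure, unfolded space_content_measure])
      have U': "U \<in> sets content_measure" "U \<subseteq> topspace X"
        using openin_content_measure[OF U(1)] openin_subset[OF U(1)] by auto
      have "A - ?K = U - ?c" using Asub U' by auto
      then have "?P (A - ?K) = ?P U - ?P ?c"
        using emeasure_Diff[of content_measure ?c U] c U U' by (simp add: emeasure_finite)
      also have "\<dots> \<le> ennreal e"
        using U(3) emeasure_finite[of ?c] by (subst ennreal_minus_le_iff) (auto simp: less_imp_le)
      finally have "?P (A - ?K) \<le> ennreal e" .
      moreover have "?P A = ?P ?K + ?P (A - ?K)"
        using plus_emeasure[of ?K content_measure "A - ?K"] K A by (auto simp: Un_absorb1)
      moreover have "?P ?K \<le> (SUP C\<in>{C. compactin X C \<and> C \<subseteq> A}. ?P C)"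
        using K by (intro SUP_upper) auto
      ultimately show "?P A \<le> (SUP C\<in>{C. compactin X C \<and> C \<subseteq> A}. ?P C) + ennreal e"
        by (simp add: add_mono)
    qed
  qed
qed (rule sets_content_measure)

text \<open>
  Inner regularity, together with a clopen set between a compact set and an open one, determines
  a regular extension on open sets; outer regularity then determines it everywhere.
\<close>

lemma regular_extension_open:
  assumes reg: "regular_borel_measure X P" and ext: "\<And>b. b \<in> B \<Longrightarrow> emeasure P b = m b"
    and U: "openin X U"
  shows "emeasure P U = open_content U"
proof (rule antisym)
  have S: "V \<in> sets P" if "openin X V" for V
    using reg that openin_content_measure sets_content_measure by (auto simp: regular_borel_measure_def)
  have "emeasure P U = (SUP C\<in>{C. compactin X C \<and> C \<subseteq> U}. emeasure P C)"
    using reg S[OF U] unfolding regular_borel_measure_def by blast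
  also have "\<dots> \<le> open_content U"
  proof (rule SUP_least)
    fix C assume "C \<in> {C. compactin X C \<and> C \<subseteq> U}"
    then obtain b where b: "b \<in> B" "C \<subseteq> b" "b \<subseteq> U"
      using compact_in_open_clopen[OF _ U] by auto
    have "emeasure P C \<le> emeasure P b"
      using b S base_open by (intro emeasure_mono) auto
    also have "\<dots> \<le> open_content U" using b ext le_open_content by auto
    finally show "emeasure P C \<le> open_content U" .
  qed
  finally show "emeasure P U \<le> open_content U" .
  show "open_content U \<le> emeasure P U"
    unfolding open_content_def
  proof (rule SUP_least)
    fix C assume "C \<in> {C \<in> B. C \<subseteq> U}"
    then show "m C \<le> emeasure P U"
      using ext[of C] S[OF U] by (auto intro!: emeasure_mono simp flip: ext)
  qed
qed

theorem ex1_regular_extension: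
  "\<exists>!P. regular_borel_measure X P \<and> (\<forall>b\<in>B. emeasure P b = m b)"
proof (rule ex1I[of _ content_measure])
  show "regular_borel_measure X content_measure \<and> (\<forall>b\<in>B. emeasure content_measure b = m b)"
    using regular_content_measure emeasure_content_measure_base by auto
next
  fix P assume "regular_borel_measure X P \<and> (\<forall>b\<in>B. emeasure P b = m b)"
  then have P: "regular_borel_measure X P" "\<And>b. b \<in> B \<Longrightarrow> emeasure P b = m b" by auto
  have sets: "sets P = sets content_measure"
    using P sets_content_measure by (auto simp: regular_borel_measure_def)
  show "P = content_measure"
  proof (rule measure_eqI)
    fix A assume A: "A \<in> sets P"
    then have "emeasure P A = (INF U\<in>{U. openin X U \<and> A \<subseteq> U}. emeasure P U)"
      using P(1) unfolding regular_borel_measure_def by blast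
    also have "\<dots> = outer_content A"
      unfolding outer_content_def
      by (rule INF_cong) (use regular_extension_open[OF P] in auto)
    also have "\<dots> = emeasure content_measure A"
      using A sets emeasure_content_measure by auto
    finally show "emeasure P A = emeasure content_measure A" .
  qed fact
qed

text \<open>
  Here \<open>\<N>\<close> may be uncountable: a clopen subset of its union, being compact, is covered by finitely many
  members.
\<close>

lemma open_content_Union_null:
  assumes N: "\<N> \<subseteq> B" "\<And>b. b \<in> \<N> \<Longrightarrow> m b = 0"
  shows "open_content (\<Union>\<N>) = 0"
proof -
  have "m C \<le> 0" if C: "C \<in> B" "C \<subseteq> \<Union>\<N>" for C
  proof -
    have "\<forall>U\<in>\<N>. openin X U" using N(1) base_open by auto
    then obtain F where F: "finite F" "F \<subseteq> \<N>" "C \<subseteq> \<Union>F"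
      using base_compact[OF C(1), unfolded compactin_def, THEN conjunct2, rule_format, of \<N>] C(2) by auto
    have "m C \<le> m (\<Union>b\<in>F. b)"
      using F N(1) C by (intro m_mono finite_UN) auto
    also have "\<dots> \<le> (\<Sum>b\<in>F. m b)"
      using F N(1) by (intro subadditive m_positive m_additive) auto
    also have "\<dots> = 0" using F(2) N(2) by (auto intro!: sum.neutral)
    finally show ?thesis .
  qed
  then show ?thesis
    unfolding open_content_def by (intro antisym SUP_least) auto
qed

end

section \<open>Formulas in one variable\<close>

lemma carrier_grp: "carrier (grp M) = {a. sort_of M a = gsort M}"
  by (simp add: grp_def)

lemma L1_mono: "A \<subseteq> A' \<Longrightarrow> L1 M s A \<subseteq> L1 M s A'"
  by (auto simp: L1_def)

lemma Neg_L1 [simp]: "Neg \<phi> \<in> L1 M s A \<longleftrightarrow> \<phi> \<in> L1 M s A"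
  and And_L1 [simp]: "And \<phi> \<psi> \<in> L1 M s A \<longleftrightarrow> \<phi> \<in> L1 M s A \<and> \<psi> \<in> L1 M s A"
  and True_L1 [simp]: "Eq (Var 0) (Var 0) \<in> L1 M s A"
  by (auto simp: L1_def)

lemma sol_Neg: "sol M (Neg \<phi>) = carrier (grp M) - sol M \<phi>"
  and sol_And: "sol M (And \<phi> \<psi>) = sol M \<phi> \<inter> sol M \<psi>"
  and sol_True: "sol M (Eq t t) = carrier (grp M)"
  and sol_subset: "sol M \<phi> \<subseteq> carrier (grp M)"
  by (auto simp: sol_def carrier_grp)

lemma sols_insert: "sols M (insert \<phi> F) = sol M \<phi> \<inter> sols M F"
  and sols_empty: "sols M {} = carrier (grp M)"
  and sols_Un: "sols M (F \<union> G) = sols M F \<inter> sols M G"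
  and sols_subset: "sols M F \<subseteq> carrier (grp M)"
  and sols_antimono: "F \<subseteq> G \<Longrightarrow> sols M G \<subseteq> sols M F"
  by (auto simp: sol_def sols_def carrier_grp)

lemma finite_conjunction:
  assumes "finite F" "F \<subseteq> Lx M A"
  shows "\<exists>\<phi>\<in>Lx M A. sol M \<phi> = sols M F"
  using assms
proof (induction F)
  case empty
  show ?case by (rule bexI[of _ "Eq (Var 0) (Var 0)"]) (auto simp: sol_True sols_empty)
next
  case (insert \<psi> F)
  then obtain \<phi> where "\<phi> \<in> Lx M A" "sol M \<phi> = sols M F" by auto
  with insert.prems show ?case
    by (intro bexI[of _ "And \<psi> \<phi>"]) (auto simp: sol_And sols_insert)
qed

section \<open>Compactness of type spaces\<close>

lemma types_consequence:
  assumes p: "p \<in> types M A" and F: "finite F" "F \<subseteq> p" and \<phi>: "\<phi> \<in> Lx M A"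
    and sub: "sols M F \<subseteq> sol M \<phi>"
  shows "\<phi> \<in> p"
proof (rule ccontr)
  assume "\<phi> \<notin> p"
  then have "insert (Neg \<phi>) F \<subseteq> p" using p \<phi> F by (auto simp: types_def)
  then have "sols M (insert (Neg \<phi>) F) \<noteq> {}" using p F by (auto simp: types_def)
  with sub show False by (auto simp: sols_insert sol_Neg)
qed

lemma types_Lx: "p \<in> types M A \<Longrightarrow> p \<subseteq> Lx M A"
  by (simp add: types_def)

lemma types_Neg:
  assumes "p \<in> types M A" "\<phi> \<in> Lx M A"
  shows "Neg \<phi> \<in> p \<longleftrightarrow> \<phi> \<notin> p"
proof -
  have "sols M {\<phi>, Neg \<phi>} = {}" by (auto simp: sols_insert sol_Neg)
  then have "\<not> {\<phi>, Neg \<phi>} \<subseteq> p" using assms by (auto simp: types_def)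
  then show ?thesis using assms by (auto simp: types_def)
qed

lemma types_And:
  assumes "p \<in> types M A" "\<phi> \<in> Lx M A" "\<psi> \<in> Lx M A"
  shows "And \<phi> \<psi> \<in> p \<longleftrightarrow> \<phi> \<in> p \<and> \<psi> \<in> p"
proof (intro iffI conjI; (elim conjE)?)
  assume a: "And \<phi> \<psi> \<in> p"
  show "\<phi> \<in> p" by (rule types_consequence[of p M A "{And \<phi> \<psi>}"]) (use assms a in \<open>auto simp: sols_insert sol_And\<close>)
  show "\<psi> \<in> p" by (rule types_consequence[of p M A "{And \<phi> \<psi>}"]) (use assms a in \<open>auto simp: sols_insert sol_And\<close>)
next
  assume "\<phi> \<in> p" "\<psi> \<in> p"
  then show "And \<phi> \<psi> \<in> p"
    by (intro types_consequence[of p M A "{\<phi>, \<psi>}"]) (use assms in \<open>auto simp: sols_insert sol_And\<close>)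
qed

lemma realised_type:
  assumes "sort_of M a = gsort M"
  shows "{\<phi>\<in>Lx M A. sat M UNIV [a] \<phi>} \<in> types M A"
proof -
  have "sols M F \<noteq> {}" if "F \<subseteq> {\<phi>\<in>Lx M A. sat M UNIV [a] \<phi>}" for F
  proof -
    have "a \<in> sols M F" using that assms by (auto simp: sols_def)
    then show ?thesis by auto
  qed
  then show ?thesis by (simp add: types_def)
qed

text \<open>
  Lindenbaum's lemma: a maximal finitely satisfiable set of formulas is complete.
\<close>

lemma finitely_satisfiable_extends_to_type:
  assumes \<Sigma>: "\<Sigma> \<subseteq> Lx M A" and fs: "\<And>F. finite F \<Longrightarrow> F \<subseteq> \<Sigma> \<Longrightarrow> sols M F \<noteq> {}"
  shows "\<exists>p\<in>types M A. \<Sigma> \<subseteq> p"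
proof -
  let ?S = "{p. \<Sigma> \<subseteq> p \<and> p \<subseteq> Lx M A \<and> (\<forall>F. finite F \<and> F \<subseteq> p \<longrightarrow> sols M F \<noteq> {})}"
  have "\<exists>p\<in>?S. \<forall>q\<in>?S. p \<subseteq> q \<longrightarrow> q = p"
  proof (rule subset_Zorn_nonempty)
    show "?S \<noteq> {}" using assms by auto
    fix C assume C: "C \<noteq> {}" "subset.chain ?S C"
    then have CS: "C \<subseteq> ?S" by (auto simp: subset.chain_def)
    have "sols M F \<noteq> {}" if F: "finite F" "F \<subseteq> \<Union>C" for F
    proof -
      obtain p where "p \<in> C" "F \<subseteq> p"
        by (rule finite_subset_Union_chain[OF F C])
      then show ?thesis using CS F by auto
    qed
    moreover obtain p where "p \<in> C" using C(1) by auto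
    then have "\<Sigma> \<subseteq> \<Union>C" using subsetD[OF CS, of p] by auto
    moreover have "\<Union>C \<subseteq> Lx M A" using subsetD[OF CS] by (intro Union_least) simp
    ultimately show "\<Union>C \<in> ?S" by blast
  qed
  then obtain p where p: "p \<in> ?S" and max: "\<And>q. q \<in> ?S \<Longrightarrow> p \<subseteq> q \<Longrightarrow> q = p" by auto
  have "\<phi> \<in> p \<or> Neg \<phi> \<in> p" if \<phi>: "\<phi> \<in> Lx M A" for \<phi>
  proof (rule ccontr)
    assume n: "\<not> (\<phi> \<in> p \<or> Neg \<phi> \<in> p)"
    have bad: "\<exists>F. finite F \<and> F \<subseteq> p \<and> sol M \<psi> \<inter> sols M F = {}" if \<psi>: "\<psi> \<in> Lx M A" "\<psi> \<notin> p" for \<psi>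
    proof -
      have "insert \<psi> p \<notin> ?S" using max[of "insert \<psi> p"] \<psi> by auto
      then obtain F where F: "finite F" "F \<subseteq> insert \<psi> p" "sols M F = {}"
        using p \<psi> by auto
      have "sol M \<psi> \<inter> sols M (F - {\<psi>}) \<subseteq> sols M F"
        by (auto simp: sols_def sol_def)
      with F show ?thesis by (intro exI[of _ "F - {\<psi>}"]) auto
    qed
    obtain F where F: "finite F" "F \<subseteq> p" "sol M \<phi> \<inter> sols M F = {}" using bad[of \<phi>] n \<phi> by auto
    obtain G where G: "finite G" "G \<subseteq> p" "sol M (Neg \<phi>) \<inter> sols M G = {}" using bad[of "Neg \<phi>"] n \<phi> by auto
    have "sols M (F \<union> G) = {}" using F(3) G(3) sols_subset[of M F] by (auto simp: sols_Un sol_Neg)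
    moreover have "finite (F \<union> G)" "F \<union> G \<subseteq> p" using F G by auto
    ultimately show False using p by blast
  qed
  then show ?thesis using p by (intro bexI[of _ p]) (auto simp: types_def)
qed

definition type_clopen :: "('f, 'r, 's, 'a) fo_struct \<Rightarrow> 'a set \<Rightarrow> ('f, 'r, 's, 'a) fm \<Rightarrow> ('f, 'r, 's, 'a) fm set set" where
  "type_clopen M A \<phi> = {p \<in> types M A. \<phi> \<in> p}"

lemma type_clopen_Neg: "\<phi> \<in> Lx M A \<Longrightarrow> type_clopen M A (Neg \<phi>) = types M A - type_clopen M A \<phi>"
  by (auto simp: type_clopen_def types_Neg)

lemma type_clopen_And:
  "\<phi> \<in> Lx M A \<Longrightarrow> \<psi> \<in> Lx M A \<Longrightarrow> type_clopen M A (And \<phi> \<psi>) = type_clopen M A \<phi> \<inter> type_clopen M A \<psi>"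
  by (auto simp: type_clopen_def types_And)

lemma type_clopen_top:
  assumes "\<phi> \<in> Lx M A" "sol M \<phi> = carrier (grp M)"
  shows "type_clopen M A \<phi> = types M A"
  using types_consequence[of _ M A "{}" \<phi>] assms by (auto simp: type_clopen_def sols_empty)

text \<open>
  Every element realises a type over \<open>A\<close>, so distinct definable sets give distinct clopen sets. This
  is what makes the value of a Keisler measure on a clopen set well defined.
\<close>

lemma type_clopen_subset_iff:
  assumes "\<phi> \<in> Lx M A" "\<psi> \<in> Lx M A"
  shows "type_clopen M A \<phi> \<subseteq> type_clopen M A \<psi> \<longleftrightarrow> sol M \<phi> \<subseteq> sol M \<psi>"
proof
  assume sub: "type_clopen M A \<phi> \<subseteq> type_clopen M A \<psi>"
  show "sol M \<phi> \<subseteq> sol M \<psi>"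
  proof
    fix a assume a: "a \<in> sol M \<phi>"
    then have "{\<theta>\<in>Lx M A. sat M UNIV [a] \<theta>} \<in> type_clopen M A \<phi>"
      using assms realised_type[of M a A] by (auto simp: sol_def type_clopen_def)
    with sub a show "a \<in> sol M \<psi>" by (auto simp: type_clopen_def sol_def)
  qed
next
  assume "sol M \<phi> \<subseteq> sol M \<psi>"
  then show "type_clopen M A \<phi> \<subseteq> type_clopen M A \<psi>"
    using assms types_consequence[of _ M A "{\<phi>}" \<psi>] by (auto simp: type_clopen_def sols_insert)
qed

lemma topspace_type_space: "topspace (type_space M A) = types M A"
proof -
  have "type_clopen M A (Eq (Var 0) (Var 0)) = types M A"
    by (rule type_clopen_top) (auto simp: sol_True)
  then show ?thesis
    unfolding type_space_def topology_generated_by_topspace type_clopen_def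
    by (auto intro!: bexI[of _ "Eq (Var 0) (Var 0)"])
qed

lemma algebra_type_clopen: "algebra (types M A) (type_clopen M A ` Lx M A)"
  unfolding algebra_iff_Int
proof (intro conjI ballI)
  show "type_clopen M A ` Lx M A \<subseteq> Pow (types M A)" by (auto simp: type_clopen_def)
  have "type_clopen M A (Neg (Eq (Var 0) (Var 0))) = {}"
    using type_clopen_top[of "Eq (Var 0) (Var 0)" M A] by (simp add: type_clopen_Neg sol_True)
  then show "{} \<in> type_clopen M A ` Lx M A"
    by (intro image_eqI[of _ _ "Neg (Eq (Var 0) (Var 0))"]) auto
next
  fix a assume "a \<in> type_clopen M A ` Lx M A"
  then show "types M A - a \<in> type_clopen M A ` Lx M A"
    by (auto simp flip: type_clopen_Neg)
next
  fix a b assume "a \<in> type_clopen M A ` Lx M A" "b \<in> type_clopen M A ` Lx M A"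
  then show "a \<inter> b \<in> type_clopen M A ` Lx M A"
    by (auto simp flip: type_clopen_And)
qed

lemma openin_type_clopen: "\<phi> \<in> Lx M A \<Longrightarrow> openin (type_space M A) (type_clopen M A \<phi>)"
  unfolding type_space_def type_clopen_def by (rule topology_generated_by_Basis) auto

lemma type_space_base:
  assumes "openin (type_space M A) U" "p \<in> U"
  shows "\<exists>\<phi>\<in>Lx M A. p \<in> type_clopen M A \<phi> \<and> type_clopen M A \<phi> \<subseteq> U"
proof -
  have "generate_topology_on (type_clopen M A ` Lx M A) U"
    using openin_topology_generated_by[OF assms(1)[unfolded type_space_def]]
    by (simp add: type_clopen_def[abs_def])
  then show ?thesis using assms(2)
  proof (induction U rule: generate_topology_on.induct)
    case (Int a b)
    then obtain \<phi> \<psi> where "\<phi> \<in> Lx M A" "p \<in> type_clopen M A \<phi>" "type_clopen M A \<phi> \<subseteq> a"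
      "\<psi> \<in> Lx M A" "p \<in> type_clopen M A \<psi>" "type_clopen M A \<psi> \<subseteq> b" by blast
    then show ?case by (intro bexI[of _ "And \<phi> \<psi>"]) (auto simp: type_clopen_And)
  next
    case (UN K)
    then obtain k where "k \<in> K" "p \<in> k" by auto
    with UN.IH[of k] show ?case by blast
  qed auto
qed

text \<open>
  For an open cover, consider the formulas whose clopen set lies in a member of the cover. Their
  negations cannot all belong to one type, so finitely many of them are already inconsistent, and
  the corresponding clopen sets cover.
\<close>

lemma compact_type_space: "compact_space (type_space M A)"
  unfolding compact_space_def compactin_def topspace_type_space
proof (intro conjI allI impI subset_refl, elim conjE)
  fix \<U> assume op: "\<forall>U\<in>\<U>. openin (type_space M A) U" and cov: "types M A \<subseteq> \<Union>\<U>"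
  let ?G = "{\<phi>\<in>Lx M A. \<exists>U\<in>\<U>. type_clopen M A \<phi> \<subseteq> U}"
  have "\<not> (\<exists>p\<in>types M A. Neg ` ?G \<subseteq> p)"
  proof
    assume "\<exists>p\<in>types M A. Neg ` ?G \<subseteq> p"
    then obtain p where p: "p \<in> types M A" "Neg ` ?G \<subseteq> p" by auto
    then obtain U where U: "U \<in> \<U>" "p \<in> U" using cov by auto
    obtain \<phi> where "\<phi> \<in> Lx M A" "p \<in> type_clopen M A \<phi>" "type_clopen M A \<phi> \<subseteq> U"
      using type_space_base[OF _ U(2)] op U(1) by blast
    with p U types_Neg[OF p(1), of \<phi>] show False by (auto simp: type_clopen_def)
  qed
  then have "\<not> (\<forall>F. finite F \<longrightarrow> F \<subseteq> Neg ` ?G \<longrightarrow> sols M F \<noteq> {})"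
    using finitely_satisfiable_extends_to_type[of "Neg ` ?G" M A] by fastforce
  then obtain F where F: "finite F" "F \<subseteq> Neg ` ?G" "sols M F = {}" by blast
  obtain G where "G \<subseteq> ?G" "finite G" "F = Neg ` G"
    using finite_subset_image[OF F(1,2)] by (elim exE conjE)
  with F(3) have G: "finite G" "G \<subseteq> ?G" "sols M (Neg ` G) = {}" by simp_all
  then have "\<forall>\<phi>\<in>G. \<exists>U\<in>\<U>. type_clopen M A \<phi> \<subseteq> U" by auto
  then obtain u where u: "\<And>\<phi>. \<phi> \<in> G \<Longrightarrow> u \<phi> \<in> \<U> \<and> type_clopen M A \<phi> \<subseteq> u \<phi>" by metis
  have "types M A \<subseteq> \<Union>(u ` G)"
  proof
    fix p assume p: "p \<in> types M A"
    have "\<not> Neg ` G \<subseteq> p" using p G by (auto simp: types_def)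
    then obtain \<phi> where "\<phi> \<in> G" "\<phi> \<in> p" using types_Neg[OF p] G(2) by auto
    then show "p \<in> \<Union>(u ` G)" using u[of \<phi>] p by (auto simp: type_clopen_def)
  qed
  then show "\<exists>\<F>. finite \<F> \<and> \<F> \<subseteq> \<U> \<and> types M A \<subseteq> \<Union>\<F>"
    using G(1) u by (intro exI[of _ "u ` G"]) auto
qed

section \<open>Keisler measures\<close>

context
  fixes M :: "('f, 'r, 's, 'a) fo_struct" and A :: "'a set" and \<mu> :: "('f, 'r, 's, 'a) fm \<Rightarrow> real"
  assumes \<mu>: "\<mu> \<in> keisler M A"
begin

lemma keisler_nonneg: "\<phi> \<in> Lx M A \<Longrightarrow> 0 \<le> \<mu> \<phi>"
  using \<mu> unfolding keisler_def by blast

lemma keisler_cong: "\<phi> \<in> Lx M A \<Longrightarrow> \<psi> \<in> Lx M A \<Longrightarrow> sol M \<phi> = sol M \<psi> \<Longrightarrow> \<mu> \<phi> = \<mu> \<psi>"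
  using \<mu> unfolding keisler_def by blast

lemma keisler_top: "\<phi> \<in> Lx M A \<Longrightarrow> sol M \<phi> = carrier (grp M) \<Longrightarrow> \<mu> \<phi> = 1"
  using \<mu> unfolding keisler_def by blast

lemma keisler_disjoint_Or:
  "\<phi> \<in> Lx M A \<Longrightarrow> \<psi> \<in> Lx M A \<Longrightarrow> sol M \<phi> \<inter> sol M \<psi> = {} \<Longrightarrow> \<mu> (Or \<phi> \<psi>) = \<mu> \<phi> + \<mu> \<psi>"
  using \<mu> unfolding keisler_def sol_And by blast

lemma keisler_Neg:
  assumes "\<phi> \<in> Lx M A" shows "\<mu> (Neg \<phi>) = 1 - \<mu> \<phi>"
proof -
  have "\<mu> (Or \<phi> (Neg \<phi>)) = \<mu> \<phi> + \<mu> (Neg \<phi>)"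
    using assms by (intro keisler_disjoint_Or) (auto simp: sol_Neg)
  moreover have "\<mu> (Or \<phi> (Neg \<phi>)) = 1"
    using assms by (intro keisler_top) (auto simp: sol_Neg sol_And)
  ultimately show ?thesis by simp
qed

lemma keisler_le_1: "\<phi> \<in> Lx M A \<Longrightarrow> \<mu> \<phi> \<le> 1"
  using keisler_Neg[of \<phi>] keisler_nonneg[of "Neg \<phi>"] by simp

text \<open>
  Two disjoint formulas have total measure at most \<open>1\<close>.
\<close>

lemma keisler_overlap:
  assumes "\<phi> \<in> Lx M A" "\<psi> \<in> Lx M A" "\<mu> \<phi> + \<mu> \<psi> > 1"
  shows "sol M \<phi> \<inter> sol M \<psi> \<noteq> {}"
  using keisler_disjoint_Or[of \<phi> \<psi>] keisler_le_1[of "Or \<phi> \<psi>"] assms by auto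

definition clopen_value :: "('f, 'r, 's, 'a) fm set set \<Rightarrow> ennreal" where
  "clopen_value b = ennreal (\<mu> (SOME \<phi>. \<phi> \<in> Lx M A \<and> type_clopen M A \<phi> = b))"

lemma clopen_value:
  assumes "\<phi> \<in> Lx M A" shows "clopen_value (type_clopen M A \<phi>) = ennreal (\<mu> \<phi>)"
proof -
  let ?\<psi> = "SOME \<psi>. \<psi> \<in> Lx M A \<and> type_clopen M A \<psi> = type_clopen M A \<phi>"
  have "?\<psi> \<in> Lx M A \<and> type_clopen M A ?\<psi> = type_clopen M A \<phi>"
    by (rule someI[of _ \<phi>]) (use assms in auto)
  moreover from this have "sol M ?\<psi> = sol M \<phi>"
    using type_clopen_subset_iff[of ?\<psi> M A \<phi>] type_clopen_subset_iff[of \<phi> M A ?\<psi>] assms by auto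
  ultimately show ?thesis
    unfolding clopen_value_def using keisler_cong[of ?\<psi> \<phi>] assms by simp
qed

lemma clopen_content_keisler:
  "clopen_content (type_space M A) (type_clopen M A ` Lx M A) clopen_value"
proof (intro clopen_content.intro clopen_content_axioms.intro)
  show "algebra (topspace (type_space M A)) (type_clopen M A ` Lx M A)"
    by (simp add: topspace_type_space algebra_type_clopen)
  show "compact_space (type_space M A)" by (rule compact_type_space)
  show "openin (type_space M A) b" if "b \<in> type_clopen M A ` Lx M A" for b
    using that openin_type_clopen by auto
  show "\<exists>b\<in>type_clopen M A ` Lx M A. p \<in> b \<and> b \<subseteq> U" if "openin (type_space M A) U" "p \<in> U" for U p
    using type_space_base[OF that] by auto
  have top: "type_clopen M A (Eq (Var 0) (Var 0)) = types M A"
    by (rule type_clopen_top) (auto simp: sol_True)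
  then have "clopen_value (types M A) = 1"
    using clopen_value[of "Eq (Var 0) (Var 0)"] keisler_top[of "Eq (Var 0) (Var 0)"]
    by (simp add: sol_True)
  then show "clopen_value (topspace (type_space M A)) < \<infinity>"
    by (simp add: topspace_type_space)
  let ?bot = "Neg (Eq (Var 0) (Var 0))"
  have "type_clopen M A ?bot = {}" using top by (simp add: type_clopen_Neg)
  moreover have "\<mu> ?bot = 0"
    using keisler_top[of "Eq (Var 0) (Var 0)"] by (simp add: keisler_Neg sol_True)
  ultimately have "clopen_value {} = 0"
    using clopen_value[of ?bot] by simp
  then show "positive (type_clopen M A ` Lx M A) clopen_value"
    by (simp add: positive_def)
  have "clopen_value (type_clopen M A \<phi> \<union> type_clopen M A \<psi>)
      = clopen_value (type_clopen M A \<phi>) + clopen_value (type_clopen M A \<psi>)"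
    if L: "\<phi> \<in> Lx M A" "\<psi> \<in> Lx M A" and d: "type_clopen M A \<phi> \<inter> type_clopen M A \<psi> = {}" for \<phi> \<psi>
  proof -
    have "type_clopen M A (And \<phi> \<psi>) \<subseteq> type_clopen M A ?bot"
      using L d by (simp add: type_clopen_And)
    then have "sol M (And \<phi> \<psi>) \<subseteq> sol M ?bot"
      using L by (subst (asm) type_clopen_subset_iff) auto
    then have "\<mu> (Or \<phi> \<psi>) = \<mu> \<phi> + \<mu> \<psi>"
      using L by (intro keisler_disjoint_Or) (auto simp: sol_And sol_Neg sol_True)
    moreover have "type_clopen M A (Or \<phi> \<psi>) = type_clopen M A \<phi> \<union> type_clopen M A \<psi>"
      using L by (auto simp: type_clopen_Neg type_clopen_And) (auto simp: type_clopen_def)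
    ultimately show ?thesis
      using L clopen_value[of "Or \<phi> \<psi>"] by (simp add: clopen_value keisler_nonneg)
  qed
  then show "additive (type_clopen M A ` Lx M A) clopen_value"
    by (auto simp: additive_def)
qed

interpretation K: clopen_content "type_space M A" "type_clopen M A ` Lx M A" clopen_value
  by (rule clopen_content_keisler)

text \<open>
  Existence and uniqueness justify the definite description in the definition of \<open>borel_ext\<close>.
\<close>

lemma borel_ext_spec:
  shows regular_borel_ext: "regular_borel_measure (type_space M A) (borel_ext M A \<mu>)"
    and emeasure_borel_ext_clopen:
      "\<phi> \<in> Lx M A \<Longrightarrow> emeasure (borel_ext M A \<mu>) (type_clopen M A \<phi>) = ennreal (\<mu> \<phi>)"
proof -
  have "\<exists>!P. regular_borel_measure (type_space M A) P \<and>
     (\<forall>\<phi>\<in>Lx M A. emeasure P {p \<in> types M A. \<phi> \<in> p} = ennreal (\<mu> \<phi>))"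
    using K.ex1_regular_extension by (simp add: clopen_value flip: type_clopen_def)
  from theI'[OF this, folded borel_ext_def]
  show "regular_borel_measure (type_space M A) (borel_ext M A \<mu>)"
    and "\<phi> \<in> Lx M A \<Longrightarrow> emeasure (borel_ext M A \<mu>) (type_clopen M A \<phi>) = ennreal (\<mu> \<phi>)"
    by (auto simp: type_clopen_def)
qed

lemma openin_borel_ext: "openin (type_space M A) U \<Longrightarrow> U \<in> sets (borel_ext M A \<mu>)"
  using regular_borel_ext K.openin_content_measure K.sets_content_measure
  by (auto simp: regular_borel_measure_def)

lemma space_borel_ext: "space (borel_ext M A \<mu>) = types M A"
  using sets_eq_imp_space_eq[of "borel_ext M A \<mu>" K.content_measure] regular_borel_ext K.sets_content_measure
  by (auto simp: regular_borel_measure_def K.space_content_measure topspace_type_space)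

lemma prob_space_borel_ext: "emeasure (borel_ext M A \<mu>) (types M A) = 1"
  using emeasure_borel_ext_clopen[of "Eq (Var 0) (Var 0)"]
    keisler_top[of "Eq (Var 0) (Var 0)"] type_clopen_top[of "Eq (Var 0) (Var 0)" M A]
  by (simp add: sol_True)

text \<open>
  The complement of the support is the union of all clopen sets of measure \<open>0\<close>, which is null by
  regularity, although the union need not be countable.
\<close>

lemma supp_full_measure:
  "supp M A \<mu> \<in> sets (borel_ext M A \<mu>)" "emeasure (borel_ext M A \<mu>) (supp M A \<mu>) = 1"
proof -
  let ?P = "borel_ext M A \<mu>"
  let ?N = "type_clopen M A ` {\<phi>\<in>Lx M A. \<mu> \<phi> = 0}"
  have compl: "supp M A \<mu> = types M A - \<Union>?N"
    using keisler_nonneg types_Lx[of _ M A]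
    by (auto simp: supp_def type_clopen_def order_less_le subset_eq)
  have op: "openin (type_space M A) (\<Union>?N)"
    using openin_type_clopen by (intro openin_Union) auto
  then have ms: "\<Union>?N \<in> sets ?P" by (rule openin_borel_ext)
  then show "supp M A \<mu> \<in> sets ?P"
    unfolding compl using sets.compl_sets[OF ms] by (simp add: space_borel_ext)
  have "emeasure ?P (\<Union>?N) = K.open_content (\<Union>?N)"
    using op by (intro K.regular_extension_open regular_borel_ext)
       (auto simp: emeasure_borel_ext_clopen clopen_value)
  also have "\<dots> = 0"
    by (rule K.open_content_Union_null) (auto simp: clopen_value)
  finally have "emeasure ?P (\<Union>?N) = 0" .
  then show "emeasure ?P (supp M A \<mu>) = 1"
    unfolding compl using emeasure_Diff_null_set[of "\<Union>?N" ?P "types M A"] ms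
      prob_space_borel_ext openin_borel_ext[OF openin_topspace] by (auto simp: null_sets_def topspace_type_space)
qed

end

lemma restr_keisler:
  assumes "\<mu> \<in> keisler M A'" "A \<subseteq> A'"
  shows "restr M A \<mu> \<in> keisler M A"
proof -
  have L: "\<phi> \<in> Lx M A \<Longrightarrow> \<phi> \<in> Lx M A'" for \<phi>
    using subsetD[OF L1_mono[OF assms(2)]] .
  have R: "\<phi> \<in> Lx M A \<Longrightarrow> restr M A \<mu> \<phi> = \<mu> \<phi>" for \<phi>
    by (simp add: restr_def)
  show ?thesis
    unfolding keisler_def
  proof (intro CollectI conjI ballI impI)
    show "restr M A \<mu> \<in> extensional (Lx M A)" by (simp add: restr_def)
    fix \<phi> assume \<phi>: "\<phi> \<in> Lx M A"
    show "0 \<le> restr M A \<mu> \<phi>"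
      using keisler_nonneg[OF assms(1) L[OF \<phi>]] R[OF \<phi>] by simp
    show "restr M A \<mu> \<phi> = 1" if "sol M \<phi> = carrier (grp M)"
      using keisler_top[OF assms(1) L[OF \<phi>] that] R[OF \<phi>] by simp
    fix \<psi> assume \<psi>: "\<psi> \<in> Lx M A"
    show "restr M A \<mu> \<phi> = restr M A \<mu> \<psi>" if "sol M \<phi> = sol M \<psi>"
      using keisler_cong[OF assms(1) L[OF \<phi>] L[OF \<psi>] that] R[OF \<phi>] R[OF \<psi>] by simp
    show "restr M A \<mu> (Or \<phi> \<psi>) = restr M A \<mu> \<phi> + restr M A \<mu> \<psi>"
      if "sol M (And \<phi> \<psi>) = {}"
      using keisler_disjoint_Or[OF assms(1) L[OF \<phi>] L[OF \<psi>]] that R[OF \<phi>] R[OF \<psi>] R[of "Or \<phi> \<psi>"] \<phi> \<psi>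
      by (simp add: sol_And)
  qed
qed

text \<open>
  The clopen set of \<open>\<gamma>\<close> contains all types that extend \<open>H\<close>.
\<close>

lemma ptype_measure_1_conjunction:
  assumes \<nu>: "\<nu> \<in> keisler M UNIV" and H: "ptype_measure M \<nu> H = 1"
    and G: "finite G" "G \<subseteq> H" and \<gamma>: "\<gamma> \<in> Lx M UNIV" "sol M \<gamma> = sols M G"
  shows "\<nu> \<gamma> = 1"
proof -
  let ?P = "borel_ext M UNIV \<nu>"
  interpret finite_measure ?P
    by (rule finite_measureI) (simp add: space_borel_ext[OF \<nu>] prob_space_borel_ext[OF \<nu>])
  have "{p \<in> types M UNIV. H \<subseteq> p} \<subseteq> type_clopen M UNIV \<gamma>"
    using types_consequence[of _ M UNIV G \<gamma>] G \<gamma> by (auto simp: type_clopen_def)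
  then have "1 \<le> measure ?P (type_clopen M UNIV \<gamma>)"
    unfolding H[symmetric] ptype_measure_def
    by (rule finite_measure_mono) (rule openin_borel_ext[OF \<nu> openin_type_clopen[OF \<gamma>(1)]])
  also have "\<dots> = \<nu> \<gamma>"
    using emeasure_borel_ext_clopen[OF \<nu> \<gamma>(1)] keisler_nonneg[OF \<nu> \<gamma>(1)]
    by (simp add: measure_def)
  finally show ?thesis using keisler_le_1[OF \<nu> \<gamma>(1)] by simp
qed

text \<open>
  A finite part of \<open>q\<close> is equivalent to a formula of \<open>q\<close>, hence of positive measure; a finite part of \<open>H\<close>
  is equivalent to a formula of measure \<open>1\<close>; two such formulas overlap. The parameters of
  \<open>H\<close> may lie outside \<open>N\<close>.
\<close>

lemma supp_type_consistent:
  assumes \<nu>: "\<nu> \<in> keisler M UNIV" and H: "ptype_measure M \<nu> H = 1" "H \<subseteq> Lx M UNIV"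
    and q: "q \<in> supp M N (restr M N \<nu>)" and F: "finite F" "F \<subseteq> q \<union> H"
  shows "sols M F \<noteq> {}"
proof -
  have qt: "q \<in> types M N" and pos: "\<And>\<phi>. \<phi> \<in> q \<Longrightarrow> \<nu> \<phi> > 0"
    using q types_Lx[of q M N] by (auto simp: supp_def restr_def subset_eq)
  have "F \<inter> q \<subseteq> Lx M N" using types_Lx[OF qt] by auto
  then obtain \<phi> where \<phi>: "\<phi> \<in> Lx M N" "sol M \<phi> = sols M (F \<inter> q)"
    using finite_conjunction[of "F \<inter> q" M N] F by auto
  have "\<phi> \<in> q" by (rule types_consequence[OF qt, of "F \<inter> q"]) (use F \<phi> in auto)
  then have "\<nu> \<phi> > 0" by (rule pos)
  obtain \<gamma> where \<gamma>: "\<gamma> \<in> Lx M UNIV" "sol M \<gamma> = sols M (F \<inter> H)"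
    using finite_conjunction[of "F \<inter> H" M UNIV] F H(2) by auto
  have "\<nu> \<gamma> = 1"
    by (rule ptype_measure_1_conjunction[OF \<nu> H(1) _ _ \<gamma>]) (use F in auto)
  then have "sol M \<phi> \<inter> sol M \<gamma> \<noteq> {}"
    using \<open>\<nu> \<phi> > 0\<close> \<phi>(1) \<gamma>(1) L1_mono[of N UNIV M "gsort M"] by (intro keisler_overlap[OF \<nu>]) auto
  moreover have "sols M F = sols M (F \<inter> q) \<inter> sols M (F \<inter> H)"
    unfolding sols_Un[symmetric] using F(2) by (intro arg_cong[of _ _ "sols M"]) auto
  ultimately show ?thesis using \<phi> \<gamma> by simp
qed

section \<open>Small elementary submodels\<close>

definition witness_closed :: "('f, 'r, 's, 'a) fo_struct \<Rightarrow> 'a set \<Rightarrow> bool" where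
  "witness_closed M N \<longleftrightarrow> (\<forall>s \<phi> e. set e \<subseteq> N \<and> wf_fm M (map (sort_of M) e) (Ex s \<phi>) \<and>
     params \<phi> = {} \<and> sat M UNIV e (Ex s \<phi>) \<longrightarrow> (\<exists>a\<in>N. sort_of M a = s \<and> sat M UNIV (a # e) \<phi>))"

text \<open>
  Closure under the function symbols is a special case of closure under witnesses, applied to the
  formula \<open>y = f(x\<^sub>1, \<dots>, x\<^sub>n)\<close>.
\<close>

lemma Tarski_Vaught:
  assumes str: "is_fo_struct M" and wc: "witness_closed M N"
  shows "elementary_substruct M N"
  unfolding elementary_substruct_def
proof (intro conjI allI impI; elim conjE)
  have W: "\<exists>a\<in>N. sort_of M a = s \<and> sat M UNIV (a # e) \<phi>"
    if "set e \<subseteq> N" "wf_fm M (s # map (sort_of M) e) \<phi>" "params \<phi> = {}"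
      "sort_of M b = s" "sat M UNIV (b # e) \<phi>" for e s \<phi> b
    using wc[unfolded witness_closed_def, rule_format, of e s \<phi>] that by auto
  fix f ss s as assume f: "fsig M f = Some (ss, s)" and as: "map (sort_of M) as = ss" "set as \<subseteq> N"
  let ?t = "Fn f (map (\<lambda>i. Var (Suc i)) [0..<length as]) :: (_, 'd) tm"
  have val: "tm_val M (a # as) ?t = fint M f as" for a
    by (simp add: comp_def map_nth)
  have par: "params (Eq (Var 0) ?t) = {}" by auto
  have "map (tm_sort M (s # map (sort_of M) as)) (map (\<lambda>i. Var (Suc i)) [0..<length as]) = map Some ss"
    unfolding as(1)[symmetric] by (rule nth_equalityI) auto
  then have wf: "wf_fm M (s # map (sort_of M) as) (Eq (Var 0) ?t)"
    using f by simp
  have sort: "sort_of M (fint M f as) = s"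
    using str f as(1) by (auto simp: is_fo_struct_def)
  have sat: "sat M UNIV (fint M f as # as) (Eq (Var 0) ?t)"
    by (simp only: sat.simps val) simp
  from W[OF as(2) wf par sort sat]
  obtain a where "a \<in> N" "sat M UNIV (a # as) (Eq (Var 0) ?t)" by (elim bexE conjE)
  moreover from this(2) have "a = fint M f as"
    unfolding sat.simps val by simp
  ultimately show "fint M f as \<in> N" by simp
next
  fix \<phi> e assume "wf_fm M (map (sort_of M) e) \<phi>" "params \<phi> = {}" "set e \<subseteq> N"
  then show "sat M N e \<phi> = sat M UNIV e \<phi>"
  proof (induction \<phi> arbitrary: e)
    case (Ex s \<phi>)
    have "sat M N (a # e) \<phi> = sat M UNIV (a # e) \<phi>" if "a \<in> N" "sort_of M a = s" for a
      using Ex that by auto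
    moreover have "\<exists>a\<in>N. sort_of M a = s \<and> sat M UNIV (a # e) \<phi>" if "sat M UNIV e (Ex s \<phi>)"
      using wc[unfolded witness_closed_def, rule_format, of e s \<phi>] Ex.prems that by auto
    ultimately show ?case by auto
  qed auto
qed

lemma finite_ordLess_card_of_infinite: "finite A \<Longrightarrow> infinite B \<Longrightarrow> |A| <o |B|"
  by (rule finite_ordLess_infinite) (simp_all add: Field_card_of card_of_well_order_on)

lemma card_of_lists_ordLeq:
  assumes B: "infinite B" and X: "|X| \<le>o |B|"
  shows "|lists X| \<le>o |B|"
proof -
  have n: "|{xs \<in> lists X. length xs = n}| \<le>o |B|" for n
  proof (induction n)
    case 0
    have "{xs \<in> lists X. length xs = 0} \<subseteq> {[]}" by auto
    then have "finite {xs \<in> lists X. length xs = 0}" by (rule finite_subset) simp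
    then show ?case using finite_ordLess_card_of_infinite[OF _ B] ordLess_imp_ordLeq by blast
  next
    case (Suc n)
    have "{xs \<in> lists X. length xs = Suc n}
        \<subseteq> (\<lambda>(x, xs). x # xs) ` (X \<times> {xs \<in> lists X. length xs = n})"
      by (auto simp: length_Suc_conv image_iff)
    then have "|{xs \<in> lists X. length xs = Suc n}| \<le>o |X \<times> {xs \<in> lists X. length xs = n}|"
      by (rule surj_imp_ordLeq)
    also have "|X \<times> {xs \<in> lists X. length xs = n}| \<le>o |B|"
      by (rule card_of_Times_ordLeq_infinite_Field) (use B X Suc in \<open>auto simp: Field_card_of card_of_card_order_on\<close>)
    finally show ?case .
  qed
  have "lists X = (\<Union>n\<in>UNIV. {xs \<in> lists X. length xs = n})" by auto
  moreover have "|\<Union>n\<in>(UNIV :: nat set). {xs \<in> lists X. length xs = n}| \<le>o |B|"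
    using B n by (intro card_of_UNION_ordLeq_infinite) (auto simp: infinite_iff_card_of_nat)
  ultimately show ?thesis by simp
qed

text \<open>
  The language is measured by its well-sorted parameter-free formulas, not by the types of symbols,
  which may be much larger.
\<close>

definition pure_formulas :: "('f, 'r, 's, 'a) fo_struct \<Rightarrow> ('f, 'r, 's, 'a) fm set" where
  "pure_formulas M = {\<phi>. params \<phi> = {} \<and> (\<exists>\<Gamma>. wf_fm M \<Gamma> \<phi>)}"

lemma infinite_pure_formulas: "infinite (pure_formulas M)"
proof -
  have "inj (\<lambda>i. Eq (Var i) (Var i) :: ('a, 'b, 'c, 'd) fm)" by (auto simp: inj_def)
  moreover have "Eq (Var i) (Var i) \<in> pure_formulas M" for i
    by (auto simp: pure_formulas_def intro!: exI[of _ "replicate (Suc i) (gsort M)"])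
  ultimately show ?thesis
    unfolding infinite_iff_countable_subset by blast
qed

definition witness :: "('f, 'r, 's, 'a) fo_struct \<Rightarrow> ('f, 'r, 's, 'a) fm \<Rightarrow> 'a list \<Rightarrow> 'a" where
  "witness M \<psi> e = (SOME a. \<exists>s \<phi>. \<psi> = Ex s \<phi> \<and> sort_of M a = s \<and> sat M UNIV (a # e) \<phi>)"

lemma witness_sat:
  assumes "sat M UNIV e (Ex s \<phi>)"
  shows "sort_of M (witness M (Ex s \<phi>) e) = s" "sat M UNIV (witness M (Ex s \<phi>) e # e) \<phi>"
proof -
  have "\<exists>a s' \<phi>'. Ex s \<phi> = Ex s' \<phi>' \<and> sort_of M a = s' \<and> sat M UNIV (a # e) \<phi>'"
    using assms by auto
  from someI_ex[OF this, folded witness_def]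
  show "sort_of M (witness M (Ex s \<phi>) e) = s" "sat M UNIV (witness M (Ex s \<phi>) e # e) \<phi>" by auto
qed

definition add_witnesses :: "('f, 'r, 's, 'a) fo_struct \<Rightarrow> 'a set \<Rightarrow> 'a set" where
  "add_witnesses M X = X \<union> (\<lambda>(\<psi>, e). witness M \<psi> e) ` (pure_formulas M \<times> lists X)"

text \<open>
  Adding witnesses for all formulas over the current set does not raise the cardinality above that of
  the infinite set \<open>B\<close>, and after countably many rounds all witnesses are present: the finitely many
  parameters of a formula occur at some finite stage.
\<close>

theorem downward_Loewenheim_Skolem:
  fixes M :: "('f, 'r, 's, 'a) fo_struct" and B :: "'b set"
  assumes str: "is_fo_struct M" and L: "|pure_formulas M| \<le>o |B|" and A: "|A| \<le>o |B|"
  shows "\<exists>N. A \<subseteq> N \<and> elementary_substruct M N \<and> |N| \<le>o |B|"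
proof -
  define X where "X n = (add_witnesses M ^^ n) A" for n
  have X0: "X 0 = A" and XS: "X (Suc n) = add_witnesses M (X n)" for n
    by (simp_all add: X_def)
  have B: "infinite B" using card_of_ordLeq_infinite[OF L infinite_pure_formulas] .
  have FB: "infinite (Field |B| )" "Card_order |B|" using B by (simp_all add: Field_card_of card_of_card_order_on)
  have card: "|X n| \<le>o |B|" for n
  proof (induction n)
    case (Suc n)
    have "|pure_formulas M \<times> lists (X n)| \<le>o |B|"
      using FB L card_of_lists_ordLeq[OF B Suc] by (intro card_of_Times_ordLeq_infinite_Field)
    then have "|(\<lambda>(\<psi>, e). witness M \<psi> e) ` (pure_formulas M \<times> lists (X n))| \<le>o |B|"
      using card_of_image ordLeq_transitive by blast
    then show ?case
      unfolding XS add_witnesses_def using FB Suc by (intro card_of_Un_ordLeq_infinite_Field)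
  qed (simp add: X0 A)
  have mono: "X m \<subseteq> X n" if "m \<le> n" for m n
    using that by (rule lift_Suc_mono_le[rotated]) (auto simp: XS add_witnesses_def)
  let ?N = "\<Union>n. X n"
  have fin: "\<exists>n. set e \<subseteq> X n" if "set e \<subseteq> ?N" for e
    using that
  proof (induction e)
    case (Cons a e)
    then obtain n m where "set e \<subseteq> X n" "a \<in> X m" by auto
    then have "set (a # e) \<subseteq> X (max n m)"
      using mono[of n "max n m"] mono[of m "max n m"] by auto
    then show ?case ..
  qed auto
  have "witness_closed M ?N"
    unfolding witness_closed_def
  proof (intro allI impI; elim conjE)
    fix s \<phi> e assume e: "set e \<subseteq> ?N" and wf: "wf_fm M (map (sort_of M) e) (Ex s \<phi>)"
      and p: "params \<phi> = {}" and sat: "sat M UNIV e (Ex s \<phi>)"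
    obtain n where n: "set e \<subseteq> X n" using fin[OF e] by auto
    have "Ex s \<phi> \<in> pure_formulas M" using wf p unfolding pure_formulas_def by auto
    moreover have "e \<in> lists (X n)" using n by (simp add: lists_eq_set)
    ultimately have "witness M (Ex s \<phi>) e \<in> X (Suc n)"
      unfolding XS add_witnesses_def by (intro UnI2 image_eqI[of _ _ "(Ex s \<phi>, e)"]) auto
    then show "\<exists>a\<in>?N. sort_of M a = s \<and> sat M UNIV (a # e) \<phi>"
      using witness_sat[OF sat] by (intro bexI[of _ "witness M (Ex s \<phi>) e"]) auto
  qed
  then have "elementary_substruct M ?N" by (rule Tarski_Vaught[OF str])
  moreover have "|?N| \<le>o |B|"
    using B card by (intro card_of_UNION_ordLeq_infinite) (auto simp: infinite_iff_card_of_nat)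
  moreover have "A \<subseteq> ?N" using X0 by auto
  ultimately show ?thesis by blast
qed

text \<open>
  There are infinitely many equations \<open>x\<^sub>i = x\<^sub>i\<close>, so a cardinal above the size of the language is infinite.
\<close>

lemma monster_infinite_Field:
  assumes "monster \<kappa> T M"
  shows "infinite (Field \<kappa>)"
proof
  assume "finite (Field \<kappa>)"
  have "|pure_formulas M| \<le>o |Field \<kappa>|"
    using assms card_of_Field_ordIso[of \<kappa>] unfolding monster_def pure_formulas_def
    by (meson ordIso_symmetric ordLess_imp_ordLeq ordLeq_ordIso_trans)
  then have "finite (pure_formulas M)"
    using \<open>finite (Field \<kappa>)\<close> card_of_ordLeq_finite by blast
  then show False using infinite_pure_formulas by blast
qed

lemma small_Un:
  assumes "monster \<kappa> T M" "is_small \<kappa> A" "is_small \<kappa> A'"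
  shows "is_small \<kappa> (A \<union> A')"
  using assms monster_infinite_Field[OF assms(1)] card_of_Un_ordLess_infinite_Field
  unfolding is_small_def monster_def by blast

lemma small_finite:
  assumes "monster \<kappa> T M" "finite A"
  shows "is_small \<kappa> A"
proof -
  have "|A| <o |pure_formulas M|"
    using finite_ordLess_card_of_infinite[OF assms(2) infinite_pure_formulas] .
  also have "|pure_formulas M| <o \<kappa>"
    using assms(1) by (simp add: monster_def pure_formulas_def)
  finally show ?thesis by (simp add: is_small_def)
qed

lemma small_elementary_extension:
  assumes mon: "monster \<kappa> T M" and A: "is_small \<kappa> A"
  shows "\<exists>N. A \<subseteq> N \<and> elementary_substruct M N \<and> is_small \<kappa> N"
proof -
  have str: "is_fo_struct M" and \<kappa>: "Card_order \<kappa>" and L: "|pure_formulas M| <o \<kappa>"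
    using mon by (simp_all add: monster_def pure_formulas_def)
  \<comment> \<open>a set of cardinality \<open>max |L| |A|\<close>, which is still less than \<open>\<kappa>\<close>\<close>
  let ?B = "pure_formulas M <+> A"
  have "\<exists>N. A \<subseteq> N \<and> elementary_substruct M N \<and> |N| \<le>o |?B|"
    by (rule downward_Loewenheim_Skolem[OF str card_of_Plus1 card_of_Plus2])
  moreover have "|?B| <o \<kappa>"
    using card_of_Plus_ordLess_infinite_Field[OF monster_infinite_Field[OF mon] \<kappa> L] A
    by (simp add: is_small_def)
  ultimately show ?thesis
    unfolding is_small_def using ordLeq_ordLess_trans by blast
qed

section \<open>The convolution with an invariant measure\<close>

lemma finite_params_tm: "finite (params_tm t)"
  by (induction t) auto

lemma finite_params: "finite (params \<phi>)"
  by (induction \<phi>) (auto simp: finite_params_tm)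

context
  fixes M :: "('f, 'r, 's, 'a) fo_struct" and T H :: "('f, 'r, 's, 'a) fm set"
    and \<nu> :: "('f, 'r, 's, 'a) fm \<Rightarrow> real" and \<kappa> :: "'k rel"
  assumes mon: "monster \<kappa> T M"
    and tds: "type_definable_subgroup \<kappa> M H"
    and \<nu>: "\<nu> \<in> keisler M UNIV" and \<nu>H: "ptype_measure M \<nu> H = 1"
begin

lemma H_formulas: "H \<subseteq> Lx M UNIV"
proof -
  obtain A where "H \<subseteq> Lx M A" using tds unfolding type_definable_subgroup_def by blast
  then show ?thesis using L1_mono[of A UNIV] by (rule subset_trans) simp
qed

text \<open>
  Saturation realises \<open>q\<close> together with \<open>H\<close>, since both have few parameters.
\<close>

lemma supp_type_realised_in_H:
  assumes N: "is_small \<kappa> N" and q: "q \<in> supp M N (restr M N \<nu>)"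
  shows "sols M q \<inter> sols M H \<noteq> {}"
proof -
  obtain A where A: "is_small \<kappa> A" "H \<subseteq> Lx M A"
    using tds unfolding type_definable_subgroup_def by blast
  have "q \<subseteq> Lx M N" using q types_Lx unfolding supp_def by blast
  then have sub: "q \<union> H \<subseteq> Lx M (N \<union> A)"
    using A(2) L1_mono[of N "N \<union> A" M "gsort M"] L1_mono[of A "N \<union> A" M "gsort M"] by auto
  have fs: "\<forall>F. finite F \<and> F \<subseteq> q \<union> H \<longrightarrow>
      (\<exists>a. sort_of M a = gsort M \<and> (\<forall>\<phi>\<in>F. sat M UNIV [a] \<phi>))"
  proof (intro allI impI; elim conjE)
    fix F assume "finite F" "F \<subseteq> q \<union> H"
    then have "sols M F \<noteq> {}" by (rule supp_type_consistent[OF \<nu> \<nu>H H_formulas q])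
    then show "\<exists>a. sort_of M a = gsort M \<and> (\<forall>\<phi>\<in>F. sat M UNIV [a] \<phi>)"
      by (auto simp: sols_def)
  qed
  have "saturated \<kappa> M" using mon by (simp add: monster_def)
  note this[unfolded saturated_def, THEN spec[of _ "N \<union> A"], THEN spec[of _ "gsort M"], THEN spec[of _ "q \<union> H"]]
  with small_Un[OF mon N A(1)] sub fs
  obtain a where "sort_of M a = gsort M" "\<forall>\<phi>\<in>q \<union> H. sat M UNIV [a] \<phi>" by blast
  then show ?thesis by (auto simp: sols_def)
qed

text \<open>
  Once \<open>N\<close> contains the parameters of \<open>H\<close>, realisability in the subgroup is strengthened: no
  realisation of \<open>q\<close> lies outside it.
\<close>

lemma supp_type_contains_H:
  assumes HN: "H \<subseteq> Lx M N" and q: "q \<in> supp M N (restr M N \<nu>)"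
  shows "H \<subseteq> q"
proof
  fix \<theta> assume \<theta>: "\<theta> \<in> H"
  then have L: "\<theta> \<in> Lx M N" "\<theta> \<in> Lx M UNIV" using HN H_formulas by auto
  have "\<nu> \<theta> = 1"
    by (rule ptype_measure_1_conjunction[OF \<nu> \<nu>H, of "{\<theta>}"])
       (use \<theta> L sol_subset[of M \<theta>] in \<open>auto simp: sols_insert sols_empty\<close>)
  then have "\<nu> (Neg \<theta>) = 0" using keisler_Neg[OF \<nu> L(2)] by simp
  then have "Neg \<theta> \<notin> q" using q L(1) by (auto simp: supp_def restr_def)
  then show "\<theta> \<in> q" using q L(1) by (auto simp: supp_def types_def)
qed

context
  fixes \<mu> :: "('f, 'r, 's, 'a) fm \<Rightarrow> real"
  assumes \<mu>: "\<mu> \<in> keisler M UNIV" and inv: "right_invariant M H \<mu>"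
begin

lemma invariant_translate: "\<phi> \<in> Lx M UNIV \<Longrightarrow> d \<in> sols M H \<Longrightarrow> \<mu> (rtrans M d \<phi>) = \<mu> \<phi>"
  using inv by (simp add: right_invariant_def)

text \<open>
  One realisation of \<open>q\<close> lies in the subgroup, and there invariance gives the value \<open>\<mu>(\<phi>)\<close>; by the
  assumption the other realisations give the same value.
\<close>

lemma fibre_eq:
  assumes \<phi>: "\<phi> \<in> Lx M UNIV" and N: "is_small \<kappa> N" and q: "q \<in> supp M N (restr M N \<nu>)"
    and const: "\<forall>d\<in>sols M q. \<forall>d'\<in>sols M q. \<mu> (rtrans M d \<phi>) = \<mu> (rtrans M d' \<phi>)"
  shows "fibre M \<mu> \<phi> q = \<mu> \<phi>"
proof -
  obtain d where d: "d \<in> sols M q" "d \<in> sols M H"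
    using supp_type_realised_in_H[OF N q] by auto
  have eq: "\<mu> (rtrans M d \<phi>) = \<mu> \<phi>" by (rule invariant_translate[OF \<phi> d(2)])
  show ?thesis
    unfolding fibre_def
  proof (rule the_equality)
    show "\<exists>d\<in>sols M q. \<mu> \<phi> = \<mu> (rtrans M d \<phi>)" using d(1) eq[symmetric] by (rule bexI[rotated])
    fix r assume "\<exists>d\<in>sols M q. r = \<mu> (rtrans M d \<phi>)"
    then show "r = \<mu> \<phi>" using const d(1) eq by metis
  qed
qed

text \<open>
  Any small elementary submodel that contains the parameters of \<open>\<phi>\<close> and of \<open>H\<close> is admissible.
\<close>

lemma star_model_exists:
  assumes \<phi>: "\<phi> \<in> Lx M UNIV"
  shows "\<exists>N. star_model \<kappa> M \<mu> \<nu> \<phi> N"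
proof -
  obtain A where A: "is_small \<kappa> A" "H \<subseteq> Lx M A"
    using tds unfolding type_definable_subgroup_def by blast
  obtain N where N: "params \<phi> \<union> A \<subseteq> N" "elementary_substruct M N" "is_small \<kappa> N"
    using small_elementary_extension[OF mon small_Un[OF mon small_finite[OF mon finite_params] A(1)]]
    by blast
  have HN: "H \<subseteq> Lx M N" using A(2) L1_mono[of A N M "gsort M"] N(1) by auto
  let ?S = "supp M N (restr M N \<nu>)"
  have const: "\<mu> (rtrans M d \<phi>) = \<mu> \<phi>" if "q \<in> ?S" "d \<in> sols M q" for q d
    using invariant_translate[OF \<phi>] sols_antimono[OF supp_type_contains_H[OF HN that(1)]] that(2) by blast
  have fib: "fibre M \<mu> \<phi> q = \<mu> \<phi>" if "q \<in> ?S" for q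
    using fibre_eq[OF \<phi> N(3) that] const[OF that] by simp
  have "space (borel_sigma (subtopology (type_space M N) ?S)) \<subseteq> ?S"
    by (simp add: borel_sigma_def space_measure_of_conv)
  then have "fibre M \<mu> \<phi> \<in> borel_measurable (borel_sigma (subtopology (type_space M N) ?S))
      \<longleftrightarrow> (\<lambda>_. \<mu> \<phi>) \<in> borel_measurable (borel_sigma (subtopology (type_space M N) ?S))"
    using fib by (intro measurable_cong) blast
  then show ?thesis
    using N const unfolding star_model_def by (intro exI[of _ N]) simp
qed

text \<open>
  The value is the same for every admissible \<open>N\<close>, as the definition of the convolution requires.
\<close>

lemma star_model_integral:
  assumes \<phi>: "\<phi> \<in> Lx M UNIV" and st: "star_model \<kappa> M \<mu> \<nu> \<phi> N"
  shows "(\<integral>q. fibre M \<mu> \<phi> q \<partial>(restrict_space (borel_ext M N (restr M N \<nu>)) (supp M N (restr M N \<nu>)))) = \<mu> \<phi>"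
proof -
  let ?\<nu> = "restr M N \<nu>"
  let ?P = "borel_ext M N ?\<nu>" and ?S = "supp M N (restr M N \<nu>)"
  have \<nu>N: "?\<nu> \<in> keisler M N" by (rule restr_keisler[OF \<nu>]) simp
  have S: "?S \<subseteq> space ?P" by (auto simp: space_borel_ext[OF \<nu>N] supp_def)
  have "(\<integral>q. fibre M \<mu> \<phi> q \<partial>(restrict_space ?P ?S)) = (\<integral>q. \<mu> \<phi> \<partial>(restrict_space ?P ?S))"
  proof (rule Bochner_Integration.integral_cong[OF refl])
    fix q assume "q \<in> space (restrict_space ?P ?S)"
    then have "q \<in> ?S" by (simp add: space_restrict_space)
    then show "fibre M \<mu> \<phi> q = \<mu> \<phi>"
      using fibre_eq[OF \<phi>] st unfolding star_model_def by blast
  qed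
  also have "\<dots> = measure (restrict_space ?P ?S) ?S * \<mu> \<phi>"
    using S by (simp add: space_restrict_space Int_absorb2)
  also have "measure (restrict_space ?P ?S) ?S = 1"
    using S supp_full_measure[OF \<nu>N] by (simp add: measure_def emeasure_restrict_space Int_absorb2)
  finally show ?thesis by simp
qed

theorem convolution_invariant:
  "star_Borel \<kappa> M \<mu> \<nu> \<and> convolution \<kappa> M \<mu> \<nu> = \<mu>"
proof
  show "star_Borel \<kappa> M \<mu> \<nu>"
    unfolding star_Borel_def using star_model_exists by blast
  show "convolution \<kappa> M \<mu> \<nu> = \<mu>"
  proof (rule extensionalityI[of _ "Lx M UNIV"])
    show "convolution \<kappa> M \<mu> \<nu> \<in> extensional (Lx M UNIV)" by (simp add: convolution_def)
    show "\<mu> \<in> extensional (Lx M UNIV)" using \<mu> unfolding keisler_def by blast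
    fix \<phi> assume \<phi>: "\<phi> \<in> Lx M UNIV"
    then obtain N where N: "star_model \<kappa> M \<mu> \<nu> \<phi> N" using star_model_exists by blast
    have "(THE r. \<forall>N. star_model \<kappa> M \<mu> \<nu> \<phi> N \<longrightarrow>
       r = (\<integral>q. fibre M \<mu> \<phi> q
         \<partial>(restrict_space (borel_ext M N (restr M N \<nu>)) (supp M N (restr M N \<nu>))))) = \<mu> \<phi>"
      by (rule the_equality) (use star_model_integral[OF \<phi>] N in auto)
    then show "convolution \<kappa> M \<mu> \<nu> \<phi> = \<mu> \<phi>" using \<phi> by (simp add: convolution_def)
  qed
qed

end

end

theorem proposition3p19:
  fixes M :: "('f, 'r, 's, 'a) fo_struct"
    and T H :: "('f, 'r, 's, 'a) fm set"
    and \<mu> :: "('f, 'r, 's, 'a) fm \<Rightarrow> real"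
    and \<kappa> :: "'k rel"
  assumes "monster \<kappa> T M"
    and "type_definable_subgroup \<kappa> M H"
    and "definably_amenable M H"
    and "\<mu> \<in> keisler M UNIV"
    and "right_invariant M H \<mu>"
  shows "keisler_idempotent \<kappa> M \<mu> \<and>
    (\<forall>\<nu>\<in>keisler M UNIV. ptype_measure M \<nu> H = 1 \<longrightarrow>
       star_Borel \<kappa> M \<mu> \<nu> \<and> convolution \<kappa> M \<mu> \<nu> = \<mu>)"
proof -
  have conv: "star_Borel \<kappa> M \<mu> \<nu> \<and> convolution \<kappa> M \<mu> \<nu> = \<mu>"
    if "\<nu> \<in> keisler M UNIV" "ptype_measure M \<nu> H = 1" for \<nu>
    using convolution_invariant[OF assms(1,2) that assms(4,5)] .
  moreover have "ptype_measure M \<mu> H = 1"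
    using assms(5) by (simp add: right_invariant_def)
  ultimately show ?thesis
    using assms(4) by (auto simp: keisler_idempotent_def)
qed

end
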